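(* Let $\{A(t)\}_{t\ge0}$ be a continuous time chain of $N\times N$ matrices in Class $\mathcal P^*$. Then $\mathbf{rank}(A)$ equals the number of connected components of the infinite flow graph associated with $\{A(t)\}$.
   Context: Let $\mathcal V=\{1,\dots,N\}$. A continuous time chain $\{A(t)\}_{t\ge0}$ is a family of real $N\times N$ matrices $A(t)=(a_{ij}(t))$ with zero row sums and non-negative off-diagonal entries, whose entries are measurable and locally integrable functions of $t\in[0,\infty)$. Let $\Phi(t,\tau)$, $t\ge\tau\ge0$, be the state transition matrix of $\dot x(t)=A(t)x(t)$, so $x(t)=\Phi(t,\tau)x(\tau)$; it is invertible and row-stochastic. Rank: for $\tau\ge0$ let $\mathbf{null}_\tau(A)=\{v\in\mathbb R^N : \lim_{t\to\infty}\Phi(t,\tau)v=\mathbf 0_N\}$. This is a vector space whose dimension does not depend on $\tau$; this dimension is $\mathbf{nullity}(A)$, and $\mathbf{rank}(A)=N-\mathbf{nullity}(A)$. Class $\mathcal P^*$: an absolute probability sequence for the chain is a family $\{\pi(t)\}_{t\ge0}$ of stochastic row vectors in $\mathbb R^N$ (non-negative entries summing to 1) with $\pi(\tau)=\pi(t)\Phi(t,\tau)$ for all $t\ge\tau\ge0$. The chain is in Class $\mathcal P^*$ if it admits an absolute probability sequence such that, for some constant $p^*>0$, every entry of $\pi(t)$ is $>p^*$ for all $t\ge0$. Infinite flow graph: the undirected graph $\mathcal H_2(\mathcal V,\mathcal E_2)$ in which distinct $i,j\in\mathcal V$ are linked if and only if $\int_0^\infty (a_{ij}(t)+a_{ji}(t))\,dt=\infty$.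 *)

theory Defs
  imports "HOL-Analysis.Analysis"
begin

text \<open>
  The vertex set \<open>{1, ..., N}\<close> is rendered by an arbitrary finite type \<open>'n\<close> with
  \<open>CARD('n) = N\<close>.  Time is \<open>[0, \<infinity>)\<close>: values of \<open>A\<close> at negative arguments are irrelevant.
\<close>

definition continuous_time_chain :: "(real \<Rightarrow> real ^ 'n ^ 'n) \<Rightarrow> bool" where
  "continuous_time_chain A \<longleftrightarrow>
     (\<forall>t\<ge>0. \<forall>i. (\<Sum>j\<in>UNIV. A t $ i $ j) = 0) \<and>
     (\<forall>t\<ge>0. \<forall>i j. i \<noteq> j \<longrightarrow> A t $ i $ j \<ge> 0) \<and>
     (\<forall>i j. (\<lambda>t. A t $ i $ j) \<in> borel_measurable (lebesgue_on {0..}) \<and>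
            (\<forall>T\<ge>0. set_integrable lebesgue {0..T} (\<lambda>t. A t $ i $ j)))"

text \<open>
  Solutions of \<open>x' = A x\<close> on \<open>[\<tau>, \<infinity>)\<close> are meant in the sense of Caratheodory, since \<open>A\<close> is only
  locally integrable.  The gauge integral in \<open>has_integral\<close> adds no solutions beyond the
  Lebesgue one: an indefinite integral is continuous, so \<open>x\<close> is locally bounded and the integrand
  is absolutely integrable on compact intervals.
\<close>

definition solves_from :: "(real \<Rightarrow> real ^ 'n ^ 'n) \<Rightarrow> real \<Rightarrow> (real \<Rightarrow> real ^ 'n) \<Rightarrow> bool" where
  "solves_from A \<tau> x \<longleftrightarrow>
     (\<forall>t\<ge>\<tau>. ((\<lambda>s. A s *v x s) has_integral (x t - x \<tau>)) {\<tau>..t})"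

text \<open>
  \<open>state_transition A t \<tau>\<close> is \<open>\<Phi>(t, \<tau>)\<close>, meaningful for \<open>t \<ge> \<tau> \<ge> 0\<close>.  For a continuous time chain
  the matrix exists and is unique by existence and uniqueness for the initial value problem.
\<close>

definition state_transition :: "(real \<Rightarrow> real ^ 'n ^ 'n) \<Rightarrow> real \<Rightarrow> real \<Rightarrow> real ^ 'n ^ 'n" where
  "state_transition A t \<tau> = (THE M. \<forall>x. solves_from A \<tau> x \<longrightarrow> x t = M *v x \<tau>)"

definition null_space_at :: "(real \<Rightarrow> real ^ 'n ^ 'n) \<Rightarrow> real \<Rightarrow> (real ^ 'n) set" where
  "null_space_at A \<tau> = {v. ((\<lambda>t. state_transition A t \<tau> *v v) \<longlongrightarrow> 0) at_top}"

definition chain_nullity :: "(real \<Rightarrow> real ^ 'n ^ 'n) \<Rightarrow> nat" where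
  "chain_nullity A = (THE d. \<forall>\<tau>\<ge>0. dim (null_space_at A \<tau>) = d)"

definition chain_rank :: "(real \<Rightarrow> real ^ 'n ^ 'n) \<Rightarrow> nat" where
  "chain_rank A = CARD('n) - chain_nullity A"

definition stochastic_vector :: "real ^ 'n \<Rightarrow> bool" where
  "stochastic_vector p \<longleftrightarrow> (\<forall>i. p $ i \<ge> 0) \<and> (\<Sum>i\<in>UNIV. p $ i) = 1"

definition absolute_probability_sequence ::
    "(real \<Rightarrow> real ^ 'n ^ 'n) \<Rightarrow> (real \<Rightarrow> real ^ 'n) \<Rightarrow> bool" where
  "absolute_probability_sequence A \<pi> \<longleftrightarrow>
     (\<forall>t\<ge>0. stochastic_vector (\<pi> t)) \<and>
     (\<forall>\<tau>\<ge>0. \<forall>t\<ge>\<tau>. \<pi> \<tau> = \<pi> t v* state_transition A t \<tau>)"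

definition class_P_star :: "(real \<Rightarrow> real ^ 'n ^ 'n) \<Rightarrow> bool" where
  "class_P_star A \<longleftrightarrow>
     (\<exists>\<pi>. absolute_probability_sequence A \<pi> \<and> (\<exists>p>0. \<forall>t\<ge>0. \<forall>i. \<pi> t $ i > p))"

text \<open>The edge set of the undirected graph, as a symmetric irreflexive relation.\<close>

definition infinite_flow_edges :: "(real \<Rightarrow> real ^ 'n ^ 'n) \<Rightarrow> ('n \<times> 'n) set" where
  "infinite_flow_edges A =
     {(i, j). i \<noteq> j \<and>
        (\<integral>\<^sup>+t\<in>{0..}. ennreal (A t $ i $ j + A t $ j $ i) \<partial>lebesgue) = \<infinity>}"

text \<open>
  Vertex sets of the connected components of the undirected graph on all of \<open>'n\<close> with symmetric
  edge relation \<open>E\<close>: the classes of the relation "joined by a path".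
\<close>

definition connected_components_of_graph :: "('n \<times> 'n) set \<Rightarrow> 'n set set" where
  "connected_components_of_graph E = UNIV // E\<^sup>*"

end

(*
  Along a trajectory x, Jensen's inequality makes the sum of pi_i(t) |x_i(t) - c| nonincreasing
  in t for every c, so it has a limit f(c).  Whenever some x_i visits the level c at arbitrarily
  late times, f has a kink at c whose slope jump is at least 2 p; as f is Lipschitz there are
  finitely many such levels, and by continuity each x_i converges.  The energy, the sum of
  pi_i x_i^2, dissipates at a rate controlled by a_ij (x_i - x_j)^2, so limits agree across edges
  of the infinite flow graph.  Conversely, from a late time on the total flow between distinct
  components is at most 1/4, so indicator vectors of components stay nearly invariant and the limit
  map is injective on the space U of vectors constant on components.  Hence that map has range U,
  and the null space is a complement of U.
*)
theory Submission
  imports Defs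
begin

section \<open>Caratheodory solutions\<close>

text \<open>\<open>A\<close> is only locally integrable and no regularity of \<open>\<pi>\<close> in
  time is assumed, so no weighted sum is differentiated. Two times s \<le> t are compared instead:
  x(t) is a stochastic matrix applied to x(s), and \<pi>(s) = \<pi>(t) \<Phi>(t, s) turns the defect
  in Jensen's inequality, taken row by row, into an exact difference of weighted sums. For squares
  this defect is a variance, which a single transition entry bounds from below; such an entry is in
  turn at least half the integrated rate when the interval is short. Short means that the sum of all
  |a_ij| integrates to at most 1/4, and \<open>interval_induct\<close> glues the local statements.
  Convergence of the energy alone does not give limits of single coordinates, which is why absolute
  deviations from every level c are studied first. Nonnegativity of the transition matrix and the
  estimate for mass leaking out of a component both come from one minimum principle.\<close>

locale ct_chain =
  fixes A :: "real \<Rightarrow> real ^ 'n ^ 'n"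
  assumes chain: "continuous_time_chain A"
begin

text \<open>One scalar function that dominates every entry, every row and the operator norm of
  \<open>A s\<close>, and is still locally integrable. Its integral is the clock by which an
  interval counts as short.\<close>

definition total_rate :: "real \<Rightarrow> real" where
  "total_rate s = (\<Sum>i\<in>UNIV. \<Sum>j\<in>UNIV. \<bar>A s $ i $ j\<bar>)"

lemma row_sum: "0 \<le> t \<Longrightarrow> (\<Sum>j\<in>UNIV. A t $ i $ j) = 0"
  using chain by (simp add: continuous_time_chain_def)

lemma offdiag_nonneg: "0 \<le> t \<Longrightarrow> i \<noteq> j \<Longrightarrow> 0 \<le> A t $ i $ j"
  using chain by (simp add: continuous_time_chain_def)

lemma entry_absolutely_integrable:
  assumes "0 \<le> a"
  shows "(\<lambda>s. A s $ i $ j) absolutely_integrable_on {a..b}"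
proof (cases "a \<le> b")
  case True
  then have "(\<lambda>s. A s $ i $ j) absolutely_integrable_on {0..b}"
    using chain assms by (simp add: continuous_time_chain_def)
  then show ?thesis
    by (rule set_integrable_subset) (use assms in auto)
qed simp

lemma entry_integrable: "0 \<le> a \<Longrightarrow> (\<lambda>s. A s $ i $ j) integrable_on {a..b}"
  using entry_absolutely_integrable absolutely_integrable_on_def by blast

lemma total_rate_integrable:
  assumes "0 \<le> a"
  shows "total_rate integrable_on {a..b}"
proof -
  have "(\<lambda>s. \<bar>A s $ i $ j\<bar>) integrable_on {a..b}" for i j
    using entry_absolutely_integrable[OF assms, of b i j]
    by (simp add: absolutely_integrable_on_def)
  then show ?thesis
    unfolding total_rate_def[abs_def] by (intro integrable_sum) auto
qed

lemma total_rate_nonneg: "0 \<le> total_rate s"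
  by (simp add: total_rate_def sum_nonneg)

lemma row_abs_le_total_rate: "(\<Sum>j\<in>UNIV. \<bar>A s $ i $ j\<bar>) \<le> total_rate s"
  unfolding total_rate_def
  by (rule member_le_sum[of i UNIV "\<lambda>i. \<Sum>j\<in>UNIV. \<bar>A s $ i $ j\<bar>"]) (auto simp: sum_nonneg)

lemma partial_row_le_total_rate:
  "(\<Sum>j\<in>S. A s $ i $ j) \<le> total_rate s"
proof -
  have "(\<Sum>j\<in>S. A s $ i $ j) \<le> (\<Sum>j\<in>S. \<bar>A s $ i $ j\<bar>)"
    by (intro sum_mono) auto
  also have "\<dots> \<le> (\<Sum>j\<in>UNIV. \<bar>A s $ i $ j\<bar>)"
    by (intro sum_mono2) auto
  finally show ?thesis using row_abs_le_total_rate[of s i] by linarith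
qed

lemma entry_abs_le_total_rate: "\<bar>A s $ i $ j\<bar> \<le> total_rate s"
  using member_le_sum[of j UNIV "\<lambda>j. \<bar>A s $ i $ j\<bar>"] row_abs_le_total_rate[of s i] by force

lemma norm_mult_le_total_rate: "norm (A s *v x) \<le> total_rate s * norm x"
proof -
  have "\<bar>(A s *v x) $ i\<bar> \<le> (\<Sum>j\<in>UNIV. \<bar>A s $ i $ j\<bar>) * norm x" for i
  proof -
    have "\<bar>(A s *v x) $ i\<bar> \<le> (\<Sum>j\<in>UNIV. \<bar>A s $ i $ j\<bar> * \<bar>x $ j\<bar>)"
      unfolding matrix_vector_mult_def by (simp add: sum_abs flip: abs_mult)
    also have "\<dots> \<le> (\<Sum>j\<in>UNIV. \<bar>A s $ i $ j\<bar> * norm x)"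
      by (intro sum_mono mult_left_mono) (auto simp: component_le_norm_cart)
    finally show ?thesis by (simp add: sum_distrib_right)
  qed
  then have "(\<Sum>i\<in>UNIV. \<bar>(A s *v x) $ i\<bar>) \<le> total_rate s * norm x"
    unfolding total_rate_def by (subst sum_distrib_right) (intro sum_mono)
  then show ?thesis using norm_le_l1_cart[of "A s *v x"] by linarith
qed

text \<open>The indefinite integral of \<open>total_rate\<close> is continuous, so every point has a
  neighbourhood in which all intervals around it are short; bisection then reaches the whole of
  [a, b].\<close>

lemma interval_induct [consumes 2, case_names trans small]:
  assumes "0 \<le> a" "a \<le> b"
    and trans: "\<And>r s t. a \<le> r \<Longrightarrow> r \<le> s \<Longrightarrow> s \<le> t \<Longrightarrow> P r s \<Longrightarrow> P s t \<Longrightarrow> P r t"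
    and small: "\<And>r s. a \<le> r \<Longrightarrow> r \<le> s \<Longrightarrow> integral {r..s} total_rate \<le> 1/4 \<Longrightarrow> P r s"
  shows "P a b"
proof -
  define I where "I t = integral {a..t} total_rate" for t
  \<comment> \<open>A frozen copy of the left endpoint: the bisection varies both endpoints, and c
    \<le> r keeps every subinterval to the right of the original \<open>a\<close>, hence at
    nonnegative times.\<close>
  define c where "c = a"
  have "c \<le> a \<longrightarrow> P a b"
    using \<open>a \<le> b\<close>
  proof (induction a b rule: Bolzano)
    case (trans r s t)
    then show ?case using assms(3)[of r s t] c_def by auto
  next
    case (local x)
    have "continuous_on {a..x+1} I"
      unfolding I_def by (intro indefinite_integral_continuous_1 total_rate_integrable assms)
    then obtain d where d: "d > 0" "\<And>y. y \<in> {a..x+1} \<Longrightarrow> dist y x < d \<Longrightarrow> dist (I y) (I x) < 1/8"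
      using local unfolding continuous_on_iff by (metis atLeastAtMost_iff le_add_same_cancel1 zero_less_one_class.zero_le_one zero_less_divide_1_iff zero_less_numeral)
    show ?case
    \<comment> \<open>The minimum with 1 keeps the right endpoint inside {a..x+1}, where continuity
      of \<open>I\<close> was used. The two deviations of 1/8 add up to the bound 1/4.\<close>
    proof (intro exI[of _ "min d 1"] conjI allI impI)
      fix r s assume rs: "r \<le> x \<and> x \<le> s \<and> s - r < min d 1" and "c \<le> r"
      then have "a \<le> r" by (simp add: c_def)
      with rs have "dist (I r) (I x) < 1/8" "dist (I s) (I x) < 1/8"
        by (intro d(2); auto simp: dist_real_def)+
      moreover have "I r + integral {r..s} total_rate = I s"
        unfolding I_def
        by (rule Henstock_Kurzweil_Integration.integral_combine)
          (use rs \<open>a \<le> r\<close> assms(1) total_rate_integrable in auto)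
      ultimately show "P r s"
        using rs \<open>a \<le> r\<close> unfolding dist_real_def by (intro small) linarith+
    qed (use d in auto)
  qed
  then show ?thesis by (simp add: c_def)
qed

section \<open>Integrability of the vector field along continuous curves\<close>

lemma entry_times_continuous_absolutely_integrable:
  assumes "0 \<le> a" and "continuous_on {a..b} f"
  shows "(\<lambda>s. A s $ i $ j * f s) absolutely_integrable_on {a..b}"
proof -
  have "(\<lambda>s. f s * A s $ i $ j) absolutely_integrable_on {a..b}"
  proof (rule absolutely_integrable_bounded_measurable_product_real)
    show "f \<in> borel_measurable (lebesgue_on {a..b})"
      by (intro continuous_imp_measurable_on_sets_lebesgue assms) auto
    show "bounded (f ` {a..b})"
      using assms by (intro compact_imp_bounded compact_continuous_image) auto
  qed (use assms entry_absolutely_integrable in auto)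
  then show ?thesis by (simp add: mult.commute)
qed

lemma entry_times_continuous_integrable:
  assumes "0 \<le> a" and "continuous_on {a..b} f"
  shows "(\<lambda>s. A s $ i $ j * f s) integrable_on {a..b}"
  using entry_times_continuous_absolutely_integrable[OF assms] absolutely_integrable_on_def by blast

lemma field_integrable:
  assumes "0 \<le> a" and x: "continuous_on {a..b} x"
  shows "(\<lambda>s. A s *v x s) integrable_on {a..b}"
proof -
  have entry: "(\<lambda>s. A s $ i $ j * x s $ j) integrable_on {a..b}" for i j
    using assms by (intro entry_times_continuous_integrable continuous_on_component)
  have "(\<lambda>s. \<Sum>i\<in>UNIV. \<Sum>j\<in>UNIV. (A s $ i $ j * x s $ j) *\<^sub>R axis i (1::real)) integrable_on {a..b}"
    by (intro integrable_sum finite integrable_on_scaleR_left[OF entry])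
  moreover have "(\<Sum>i\<in>UNIV. \<Sum>j\<in>UNIV. (A s $ i $ j * x s $ j) *\<^sub>R axis i (1::real)) = A s *v x s" for s
  proof (intro vec_eq_iff[THEN iffD2] allI)
    fix k
    have "(\<Sum>i\<in>UNIV. \<Sum>j\<in>UNIV. (A s $ i $ j * x s $ j) *\<^sub>R axis i (1::real)) $ k =
        (\<Sum>i\<in>UNIV. if i = k then \<Sum>j\<in>UNIV. A s $ i $ j * x s $ j else 0)"
      unfolding sum_component by (intro sum.cong) (auto simp: axis_def)
    then show "(\<Sum>i\<in>UNIV. \<Sum>j\<in>UNIV. (A s $ i $ j * x s $ j) *\<^sub>R axis i (1::real)) $ k = (A s *v x s) $ k"
      by (simp add: matrix_vector_mult_def)
  qed
  ultimately show ?thesis by simp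
qed

text \<open>The compact-interval form of \<open>solves_from\<close>: a property of two endpoints can
  be cut, glued and treated by \<open>interval_induct\<close>.\<close>

definition solves_on :: "real \<Rightarrow> real \<Rightarrow> (real \<Rightarrow> real ^ 'n) \<Rightarrow> bool" where
  "solves_on a b x \<longleftrightarrow>
     (\<forall>t\<in>{a..b}. ((\<lambda>s. A s *v x s) has_integral (x t - x a)) {a..t})"

section \<open>Restriction, gluing, uniqueness and existence on compact intervals\<close>

lemma solves_on_continuous:
  assumes "solves_on a b x"
  shows "continuous_on {a..b} x"
proof (cases "a \<le> b")
  case True
  have "(\<lambda>s. A s *v x s) integrable_on {a..b}"
    using assms True unfolding solves_on_def by fastforce
  then have "continuous_on {a..b} (\<lambda>t. x a + integral {a..t} (\<lambda>s. A s *v x s))"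
    by (intro continuous_intros indefinite_integral_continuous_1)
  moreover have "x a + integral {a..t} (\<lambda>s. A s *v x s) = x t" if "t \<in> {a..b}" for t
    using assms that by (auto simp: solves_on_def dest!: bspec integral_unique)
  ultimately show ?thesis using continuous_on_cong by (metis (no_types, lifting))
qed simp

lemma solves_on_increment:
  assumes "solves_on a b x" "a \<le> r" "r \<le> t" "t \<le> b"
  shows "((\<lambda>s. A s *v x s) has_integral (x t - x r)) {r..t}"
proof -
  have r: "((\<lambda>s. A s *v x s) has_integral (x r - x a)) {a..r}"
   and t: "((\<lambda>s. A s *v x s) has_integral (x t - x a)) {a..t}"
    using assms by (auto simp: solves_on_def)
  have "(\<lambda>s. A s *v x s) integrable_on {r..t}"
    using integrable_subinterval_real[OF has_integral_integrable[OF t]] assms by auto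
  then obtain J where J: "((\<lambda>s. A s *v x s) has_integral J) {r..t}" by blast
  have "((\<lambda>s. A s *v x s) has_integral ((x r - x a) + J)) {a..t}"
    using has_integral_combine[OF _ _ r J] assms by simp
  then have "(x r - x a) + J = x t - x a" using t has_integral_unique by blast
  then have "J = x t - x r" by (simp add: algebra_simps flip: eq_diff_eq)
  then show ?thesis using J by simp
qed

lemma solves_on_subinterval:
  assumes "solves_on a b x" "a \<le> r" "t \<le> b"
  shows "solves_on r t x"
  unfolding solves_on_def using solves_on_increment[OF assms(1,2)] assms(3) by auto

lemma solves_on_combine:
  assumes x: "solves_on a b x" and y: "solves_on b c y" and "x b = y b" "a \<le> b" "b \<le> c"
  shows "solves_on a c (\<lambda>t. if t \<le> b then x t else y t)"
proof -
  define z where "z = (\<lambda>t. if t \<le> b then x t else y t)"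
  have zx: "z t = x t" if "t \<le> b" for t using that by (simp add: z_def)
  have zy: "z t = y t" if "b \<le> t" for t using that \<open>x b = y b\<close> by (simp add: z_def)
  have 1: "((\<lambda>s. A s *v z s) has_integral (z t - z a)) {a..t}" if t: "a \<le> t" "t \<le> b" for t
  proof (rule has_integral_eq)
    show "((\<lambda>s. A s *v x s) has_integral (z t - z a)) {a..t}"
      using x t by (simp add: zx solves_on_def)
  qed (use t in \<open>simp add: zx\<close>)
  have 2: "((\<lambda>s. A s *v z s) has_integral (z t - z b)) {b..t}" if t: "b \<le> t" "t \<le> c" for t
  proof (rule has_integral_eq)
    show "((\<lambda>s. A s *v y s) has_integral (z t - z b)) {b..t}"
      using y t by (simp add: zy solves_on_def)
  qed (simp add: zy)
  have "((\<lambda>s. A s *v z s) has_integral (z t - z a)) {a..t}" if t: "t \<in> {a..c}" for t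
  proof (cases "t \<le> b")
    case True then show ?thesis using 1 t by auto
  next
    case False
    then have "((\<lambda>s. A s *v z s) has_integral ((z b - z a) + (z t - z b))) {a..t}"
      using t \<open>a \<le> b\<close> \<open>b \<le> c\<close> by (intro has_integral_combine[of a b t] 1 2) auto
    then show ?thesis by simp
  qed
  then have "solves_on a c z" by (simp add: solves_on_def)
  then show ?thesis unfolding z_def .
qed

text \<open>On a short interval the maximum of the norm is at most a quarter of itself, because x(m)
  is, up to sign, the integral of the field between the zero s and the maximiser m. The zero may lie
  anywhere, so the argument also runs backwards in time; \<open>trajectory_eq_zero\<close> uses this
  for injectivity of the flow.\<close>

lemma solves_on_zero:
  assumes "0 \<le> a" "a \<le> b" "solves_on a b x" "s \<in> {a..b}" "x s = 0" "t \<in> {a..b}"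
  shows "x t = 0"
proof -
  have "\<forall>x s. solves_on a b x \<and> s \<in> {a..b} \<and> x s = 0 \<longrightarrow> (\<forall>t\<in>{a..b}. x t = 0)"
    using assms(1,2)
  proof (induction a b rule: interval_induct)
    case (trans r u t)
    show ?case
    proof (intro allI impI)
      fix x s assume *: "solves_on r t x \<and> s \<in> {r..t} \<and> x s = 0"
      have 1: "solves_on r u x" "solves_on u t x"
        using solves_on_subinterval[of r t x r u] solves_on_subinterval[of r t x u t] * trans(2,3)
        by blast+
      have left: "x q = 0" if "p \<in> {r..u}" "x p = 0" "q \<in> {r..u}" for p q
        using trans(4) 1(1) that by blast
      have right: "x q = 0" if "p \<in> {u..t}" "x p = 0" "q \<in> {u..t}" for p q
        using trans(5) 1(2) that by blast
      have "s \<in> {r..u} \<or> s \<in> {u..t}" using * by auto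
      moreover have u: "u \<in> {r..u}" "u \<in> {u..t}" using \<open>r \<le> u\<close> \<open>u \<le> t\<close> by auto
      ultimately have "x u = 0" using left[of s u] right[of s u] * by blast
      then have "\<forall>q\<in>{r..u}. x q = 0" "\<forall>q\<in>{u..t}. x q = 0"
        using left u(1) right u(2) by blast+
      then show "\<forall>q\<in>{r..t}. x q = 0" by fastforce
    qed
  next
    case (small r u)
    show ?case
    proof (intro allI impI)
      fix x s assume *: "solves_on r u x \<and> s \<in> {r..u} \<and> x s = 0"
      then have cont: "continuous_on {r..u} x" using solves_on_continuous by blast
      have "\<exists>m\<in>{r..u}. \<forall>q\<in>{r..u}. norm (x q) \<le> norm (x m)"
        using small by (intro continuous_attains_sup continuous_on_norm cont) auto
      then obtain m where m: "m \<in> {r..u}" "\<And>q. q \<in> {r..u} \<Longrightarrow> norm (x q) \<le> norm (x m)" by blast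
      \<comment> \<open>The maximiser may lie on either side of the zero.\<close>
      define l h where "l = min s m" and "h = max s m"
      have lh: "r \<le> l" "l \<le> h" "h \<le> u" using * m by (auto simp: l_def h_def)
      have int: "((\<lambda>s. A s *v x s) has_integral (x h - x l)) {l..h}"
        using solves_on_increment * lh by blast
      have "norm (x m) = norm (x h - x l)"
        using * by (auto simp: l_def h_def max_def min_def)
      also have "\<dots> \<le> integral {l..h} (\<lambda>q. total_rate q * norm (x m))"
      proof -
        have "norm (integral {l..h} (\<lambda>s. A s *v x s)) \<le> integral {l..h} (\<lambda>q. total_rate q * norm (x m))"
        proof (rule Henstock_Kurzweil_Integration.integral_norm_bound_integral)
          fix q assume "q \<in> {l..h}"
          then have "norm (x q) \<le> norm (x m)" using m lh by auto
          then show "norm (A q *v x q) \<le> total_rate q * norm (x m)"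
            using norm_mult_le_total_rate[of q "x q"] total_rate_nonneg[of q]
            by (meson mult_left_mono order_trans)
        qed (use int lh small assms in \<open>auto intro!: total_rate_integrable integrable_on_mult_left\<close>)
        then show ?thesis using integral_unique[OF int] by simp
      qed
      also have "\<dots> = integral {l..h} total_rate * norm (x m)"
        by simp
      also have "\<dots> \<le> integral {r..u} total_rate * norm (x m)"
        using lh small assms
        by (intro mult_right_mono integral_subset_le total_rate_integrable) (auto simp: total_rate_nonneg)
      also have "\<dots> \<le> 1/4 * norm (x m)"
        using small by (intro mult_right_mono) auto
      finally have "norm (x m) \<le> 0" by simp
      then show "\<forall>q\<in>{r..u}. x q = 0" using m by fastforce
    qed
  qed
  then show ?thesis using assms by blast
qed

text \<open>Picard iteration: on a short interval the integral operator is a contraction with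
  constant 1/4.\<close>

lemma solves_on_exists_small:
  assumes "0 \<le> a" "a \<le> b" and small: "integral {a..b} total_rate \<le> 1/4"
  shows "\<exists>x. solves_on a b x \<and> x a = v"
proof -
  \<comment> \<open>The fixed point is sought among bounded continuous functions on the whole real
    line. Clamping time to [a, b] makes the integral operator map that space into itself.\<close>
  define c where "c t = max a (min b t)" for t :: real
  have c: "c t \<in> {a..b}" for t using assms by (auto simp: c_def)
  have cid: "c t = t" if "t \<in> {a..b}" for t using that by (auto simp: c_def)
  have cont_c: "continuous_on UNIV c" unfolding c_def by (intro continuous_intros)
  define G :: "(real \<Rightarrow>\<^sub>C (real ^ 'n)) \<Rightarrow> real \<Rightarrow> real ^ 'n"
    where "G x t = v + integral {a..c t} (\<lambda>s. A s *v x s)" for x t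
  have G: "G x \<in> bcontfun" for x
  proof -
    define g where "g t = v + integral {a..t} (\<lambda>s. A s *v x s)" for t
    have g: "continuous_on {a..b} g"
      unfolding g_def
      by (intro continuous_on_add continuous_on_const indefinite_integral_continuous_1
          field_integrable assms continuous_on_apply_bcontfun)
    have Gg: "G x = (\<lambda>t. g (c t))" by (auto simp: G_def g_def)
    have "continuous_on UNIV (G x)"
      unfolding Gg by (rule continuous_on_compose2[OF g cont_c]) (use c in auto)
    moreover have "bounded (g ` {a..b})"
      by (intro compact_imp_bounded compact_continuous_image g) simp
    then obtain B where "\<forall>y\<in>g ` {a..b}. norm y \<le> B" unfolding bounded_iff by blast
    then have "norm (G x t) \<le> B" for t using c unfolding Gg by blast
    ultimately show ?thesis by (rule bcontfun_normI)
  qed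
  define F where "F x = Bcontfun (G x)" for x
  have F: "apply_bcontfun (F x) = G x" for x
    unfolding F_def by (rule Bcontfun_inverse[OF G])
  have "dist (F x) (F y) \<le> 1/4 * dist x y" for x y
  proof (rule dist_bound)
    fix t
    have int: "(\<lambda>s. A s *v apply_bcontfun z s) integrable_on {a..c t}" for z
      by (intro field_integrable assms continuous_on_apply_bcontfun)
    have "dist (G x t) (G y t) =
        norm (integral {a..c t} (\<lambda>s. A s *v x s) - integral {a..c t} (\<lambda>s. A s *v y s))"
      by (simp add: G_def dist_norm)
    also have "\<dots> = norm (integral {a..c t} (\<lambda>s. A s *v (x s - y s)))"
      by (subst Henstock_Kurzweil_Integration.integral_diff[OF int int, symmetric])
        (simp add: matrix_vector_mult_diff_distrib)
    also have "\<dots> \<le> integral {a..c t} (\<lambda>s. total_rate s * dist x y)"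
    proof (rule Henstock_Kurzweil_Integration.integral_norm_bound_integral)
      show "(\<lambda>s. A s *v (x s - y s)) integrable_on {a..c t}"
        using Henstock_Kurzweil_Integration.integrable_diff[OF int int, of x y]
        by (simp add: matrix_vector_mult_diff_distrib)
      show "(\<lambda>s. total_rate s * dist x y) integrable_on {a..c t}"
        by (intro integrable_on_mult_left total_rate_integrable assms)
      fix s
      have "norm (x s - y s) \<le> dist x y" using dist_bounded[of x s y] by (simp add: dist_norm)
      then show "norm (A s *v (x s - y s)) \<le> total_rate s * dist x y"
        using norm_mult_le_total_rate[of s "x s - y s"] total_rate_nonneg[of s]
        by (meson mult_left_mono order_trans)
    qed
    also have "\<dots> = integral {a..c t} total_rate * dist x y" by simp
    also have "\<dots> \<le> integral {a..b} total_rate * dist x y"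
      using c[of t] assms
      by (intro mult_right_mono integral_subset_le total_rate_integrable)
        (auto simp: total_rate_nonneg)
    also have "\<dots> \<le> 1/4 * dist x y"
      using small by (intro mult_right_mono) auto
    finally show "dist (F x t) (F y t) \<le> 1/4 * dist x y" by (simp add: F)
  qed
  then obtain x where x: "F x = x"
    using banach_fix_type[of "1/4" F] by auto
  have eq: "apply_bcontfun x t = v + integral {a..t} (\<lambda>s. A s *v x s)" if "t \<in> {a..b}" for t
    using fun_cong[OF F[of x], of t] unfolding x G_def cid[OF that] .
  have xa: "x a = v" using eq[of a] assms by simp
  have "solves_on a b x"
    unfolding solves_on_def
  proof
    fix t assume t: "t \<in> {a..b}"
    have "(\<lambda>s. A s *v x s) integrable_on {a..t}"
      by (intro field_integrable assms continuous_on_apply_bcontfun)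
    then show "((\<lambda>s. A s *v x s) has_integral (x t - x a)) {a..t}"
      using eq[OF t] xa by (simp add: has_integral_integral)
  qed
  with xa show ?thesis by blast
qed

lemma solves_on_exists:
  assumes "0 \<le> a" "a \<le> b"
  shows "\<exists>x. solves_on a b x \<and> x a = v"
proof -
  have "\<forall>v. \<exists>x. solves_on a b x \<and> x a = v"
    using assms
  proof (induction a b rule: interval_induct)
    case (trans r u t)
    show ?case
    proof
      fix v
      obtain x where x: "solves_on r u x" "x r = v" using trans(4) by blast
      obtain y where y: "solves_on u t y" "y u = x u" using trans(5) by blast
      have "solves_on r t (\<lambda>q. if q \<le> u then x q else y q)"
        using solves_on_combine[OF x(1) y(1) y(2)[symmetric] trans(2,3)] .
      then show "\<exists>x. solves_on r t x \<and> x r = v"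
        using x(2) trans(2) by (intro exI[of _ "\<lambda>q. if q \<le> u then x q else y q"]) simp
    qed
  next
    case (small r u)
    then show ?case using solves_on_exists_small assms(1) by force
  qed
  then show ?thesis by blast
qed

lemma solves_on_diff:
  assumes "solves_on a b x" "solves_on a b y"
  shows "solves_on a b (\<lambda>t. x t - y t)"
  unfolding solves_on_def
proof
  fix t assume "t \<in> {a..b}"
  then have "((\<lambda>s. A s *v x s - A s *v y s) has_integral ((x t - x a) - (y t - y a))) {a..t}"
    using assms by (intro has_integral_diff) (auto simp: solves_on_def)
  then show "((\<lambda>s. A s *v (x s - y s)) has_integral ((x t - y t) - (x a - y a))) {a..t}"
    by (simp add: matrix_vector_mult_diff_distrib algebra_simps)
qed

lemma solves_on_scale:
  assumes "solves_on a b x"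
  shows "solves_on a b (\<lambda>t. c *\<^sub>R x t)"
  unfolding solves_on_def
proof
  fix t assume "t \<in> {a..b}"
  then have "((\<lambda>s. c *\<^sub>R (A s *v x s)) has_integral (c *\<^sub>R (x t - x a))) {a..t}"
    using assms by (intro has_integral_cmul) (auto simp: solves_on_def)
  then show "((\<lambda>s. A s *v (c *\<^sub>R x s)) has_integral (c *\<^sub>R x t - c *\<^sub>R x a)) {a..t}"
    by (simp add: matrix_vector_mult_scaleR scaleR_diff_right)
qed

lemma solves_on_add:
  assumes "solves_on a b x" "solves_on a b y"
  shows "solves_on a b (\<lambda>t. x t + y t)"
  using solves_on_diff[OF assms(1) solves_on_scale[OF assms(2), of "-1"]] by simp

lemma solves_on_unique:
  assumes "0 \<le> a" "a \<le> b" "solves_on a b x" "solves_on a b y" "s \<in> {a..b}" "x s = y s" "t \<in> {a..b}"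
  shows "x t = y t"
  using solves_on_zero[OF assms(1,2) solves_on_diff[OF assms(3,4)] assms(5) _ assms(7)] assms(6) by simp

section \<open>Solutions on half-lines and the state transition matrix\<close>

lemma solves_from_iff: "solves_from A \<tau> x \<longleftrightarrow> (\<forall>t\<ge>\<tau>. solves_on \<tau> t x)"
  unfolding solves_from_def solves_on_def by auto

text \<open>Solutions on [\<tau>, t] for different t agree where both are defined, by uniqueness, so
  the diagonal z t = x t t is a single solution for all times.\<close>

lemma solves_from_exists:
  assumes "0 \<le> \<tau>"
  shows "\<exists>x. solves_from A \<tau> x \<and> x \<tau> = v"
proof -
  have "\<forall>t. \<exists>x. \<tau> \<le> t \<longrightarrow> solves_on \<tau> t x \<and> x \<tau> = v"
    using solves_on_exists[OF assms] by blast
  from choice[OF this] obtain x where x: "\<And>t. \<tau> \<le> t \<Longrightarrow> solves_on \<tau> t (x t)" "\<And>t. \<tau> \<le> t \<Longrightarrow> x t \<tau> = v" by blast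
  define z where "z t = x t t" for t
  have agree: "x t s = z s" if "\<tau> \<le> s" "s \<le> t" for s t
    unfolding z_def
  proof (rule solves_on_unique[OF assms, where x="x t" and y="x s" and s=\<tau> and b=s])
    show "solves_on \<tau> s (x t)"
      using x(1)[of t] solves_on_subinterval[of \<tau> t "x t" \<tau> s] that by auto
    show "solves_on \<tau> s (x s)" "x t \<tau> = x s \<tau>" using x that by auto
  qed (use that in auto)
  have "solves_on \<tau> t z" if "\<tau> \<le> t" for t
    unfolding solves_on_def
  proof
    fix q assume q: "q \<in> {\<tau>..t}"
    have "((\<lambda>s. A s *v x t s) has_integral (z q - z \<tau>)) {\<tau>..q}"
      using x(1)[OF that, unfolded solves_on_def, THEN bspec, OF q] q agree[of q t] agree[of \<tau> t]
      by simp
    then show "((\<lambda>s. A s *v z s) has_integral (z q - z \<tau>)) {\<tau>..q}"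
      by (rule has_integral_eq[rotated]) (use q agree in auto)
  qed
  then show ?thesis using x(2)[of \<tau>] by (intro exI[of _ z]) (simp add: solves_from_iff z_def)
qed

text \<open>Justifies the definite description in \<open>state_transition\<close>. The matrix exists
  because the solution depends linearly on its initial value; it is unique because every vector
  occurs as an initial value.\<close>

lemma state_transition_ex1:
  assumes "0 \<le> \<tau>" "\<tau> \<le> t"
  shows "\<exists>!M. \<forall>x. solves_from A \<tau> x \<longrightarrow> x t = M *v x \<tau>"
proof -
  obtain X where X: "\<And>v. solves_from A \<tau> (X v)" "\<And>v. X v \<tau> = v"
    using solves_from_exists[OF assms(1)] by metis
  have on: "solves_on \<tau> t (X v)" for v using X assms by (simp add: solves_from_iff)
  have unique: "x t = y t" if "solves_on \<tau> t x" "solves_on \<tau> t y" "x \<tau> = y \<tau>" for x y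
    using solves_on_unique[OF assms that(1,2) _ that(3), of t] assms by simp
  have "linear (\<lambda>v. X v t)"
  proof (rule linearI)
    show "X (v + w) t = X v t + X w t" for v w
      using unique[OF on solves_on_add[OF on on]] X(2) by simp
    show "X (c *\<^sub>R v) t = c *\<^sub>R X v t" for c v
      using unique[OF on solves_on_scale[OF on]] X(2) by simp
  qed
  then have mat: "matrix (\<lambda>v. X v t) *v v = X v t" for v by (simp add: matrix_works)
  show ?thesis
  proof (rule ex1I[of _ "matrix (\<lambda>v. X v t)"])
    show "\<forall>x. solves_from A \<tau> x \<longrightarrow> x t = matrix (\<lambda>v. X v t) *v x \<tau>"
      unfolding mat using unique[OF _ on] X(2) assms by (simp add: solves_from_iff)
    fix M assume "\<forall>x. solves_from A \<tau> x \<longrightarrow> x t = M *v x \<tau>"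
    then have "M *v v = matrix (\<lambda>v. X v t) *v v" for v
      unfolding mat using X by metis
    then show "M = matrix (\<lambda>v. X v t)" by (simp add: matrix_eq)
  qed
qed

lemma state_transition_solution:
  assumes "0 \<le> \<tau>" "\<tau> \<le> t" "solves_from A \<tau> x"
  shows "state_transition A t \<tau> *v x \<tau> = x t"
  using theI'[OF state_transition_ex1[OF assms(1,2)]] assms(3) by (simp add: state_transition_def)

lemma solves_from_later:
  assumes "solves_from A \<tau> x" "\<tau> \<le> s"
  shows "solves_from A s x"
  unfolding solves_from_iff
proof (intro allI impI)
  fix t assume "s \<le> t"
  then show "solves_on s t x"
    using assms solves_on_subinterval[of \<tau> t x s t] by (simp add: solves_from_iff)
qed

section \<open>Solution curves given by the transition matrix\<close>

definition trajectory :: "real \<Rightarrow> real ^ 'n \<Rightarrow> real \<Rightarrow> real ^ 'n" where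
  "trajectory \<tau> v t = state_transition A t \<tau> *v v"

lemma trajectory_eq:
  assumes "0 \<le> \<tau>" "solves_from A \<tau> x" "\<tau> \<le> t"
  shows "trajectory \<tau> (x \<tau>) t = x t"
  using state_transition_solution[OF assms(1,3,2)] by (simp add: trajectory_def)

lemma trajectory_solves:
  assumes "0 \<le> \<tau>"
  shows "solves_from A \<tau> (trajectory \<tau> v)" "trajectory \<tau> v \<tau> = v"
proof -
  obtain x where x: "solves_from A \<tau> x" "x \<tau> = v" using solves_from_exists[OF assms] by blast
  have eq: "trajectory \<tau> v t = x t" if "\<tau> \<le> t" for t
    using trajectory_eq[OF assms x(1) that] x(2) by simp
  show "trajectory \<tau> v \<tau> = v" using eq x(2) by simp
  show "solves_from A \<tau> (trajectory \<tau> v)"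
    unfolding solves_from_def
  proof (intro allI impI)
    fix t assume t: "\<tau> \<le> t"
    have "((\<lambda>s. A s *v x s) has_integral (trajectory \<tau> v t - trajectory \<tau> v \<tau>)) {\<tau>..t}"
      using x(1) t by (simp add: solves_from_def eq)
    then show "((\<lambda>s. A s *v trajectory \<tau> v s) has_integral (trajectory \<tau> v t - trajectory \<tau> v \<tau>)) {\<tau>..t}"
      by (rule has_integral_eq[rotated]) (use eq in auto)
  qed
qed

lemma trajectory_semigroup:
  assumes "0 \<le> \<tau>" "\<tau> \<le> s" "s \<le> t"
  shows "trajectory s (trajectory \<tau> v s) t = trajectory \<tau> v t"
  using trajectory_eq[OF _ solves_from_later[OF trajectory_solves(1)]] assms by auto

lemma trajectory_continuous:
  assumes "0 \<le> \<tau>"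
  shows "continuous_on {\<tau>..t} (trajectory \<tau> v)"
  using trajectory_solves(1)[OF assms] solves_on_continuous
  by (cases "\<tau> \<le> t") (auto simp: solves_from_iff)

lemma trajectory_eq_zero:
  assumes "0 \<le> \<tau>" "\<tau> \<le> t" "trajectory \<tau> v t = 0"
  shows "v = 0"
  using solves_on_zero[of \<tau> t "trajectory \<tau> v" t \<tau>] trajectory_solves[OF assms(1), of v] assms
  by (simp add: solves_from_iff)

lemma trajectory_increment:
  assumes "0 \<le> \<tau>" "\<tau> \<le> r" "r \<le> t"
  shows "((\<lambda>s. \<Sum>j\<in>UNIV. A s $ i $ j * trajectory \<tau> v s $ j)
    has_integral (trajectory \<tau> v t $ i - trajectory \<tau> v r $ i)) {r..t}"
proof -
  have "solves_on \<tau> t (trajectory \<tau> v)"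
    using trajectory_solves(1)[OF assms(1)] assms by (simp add: solves_from_iff)
  then have "((\<lambda>s. A s *v trajectory \<tau> v s) has_integral
      (trajectory \<tau> v t - trajectory \<tau> v r)) {r..t}"
    using assms by (intro solves_on_increment) auto
  from has_integral_linear[OF this bounded_linear_vec_nth[of i]]
  show ?thesis by (simp add: o_def matrix_vector_mult_def)
qed

lemma trajectory_one:
  assumes "0 \<le> \<tau>" "\<tau> \<le> t"
  shows "trajectory \<tau> 1 t = 1"
proof -
  have "A s *v 1 = 0" if "0 \<le> s" for s
    using row_sum[OF that] by (simp add: matrix_vector_mult_def vec_eq_iff)
  then have "((\<lambda>s. A s *v 1) has_integral 0) {\<tau>..t}" for t
    by (intro has_integral_eq[OF _ has_integral_0]) (use assms in auto)
  then have "solves_from A \<tau> (\<lambda>_. 1)"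
    by (simp add: solves_from_def)
  then show ?thesis using trajectory_eq[OF assms(1), of "\<lambda>_. 1" t] assms by simp
qed

lemma linear_trajectory: "linear (\<lambda>v. trajectory \<tau> v t)"
  unfolding trajectory_def by (rule matrix_vector_mul_linear)

section \<open>Nonnegativity and stochasticity of the transition matrix\<close>

lemma row_sum_integrable:
  assumes "0 \<le> a" "\<And>j. j \<in> S \<Longrightarrow> continuous_on {a..b} (f j)"
  shows "(\<lambda>s. \<Sum>j\<in>S. A s $ i $ j * f j s) integrable_on {a..b}"
  using assms by (intro integrable_sum entry_times_continuous_integrable finite) auto

text \<open>Minimum principle for y_i' \<ge> sum of a_ij (y_j - y_i) over j in S, phrased through
  increments. Let the least value over S and [a, b] be y_i(m) < 0, and let z be the last zero of y_i
  before m. On [z, m] one has y_i \<le> 0, so y_j - y_i \<ge> y_j \<ge> y_i(m). Integrating gives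
  y_i(m) \<ge> y_i(m) / 4, which is impossible. \<open>S\<close> is the whole index set when
  trajectories are shown to be nonnegative, and one component when leakage is estimated.\<close>

lemma supersolution_nonneg_small:
  assumes "0 \<le> a" "a \<le> b" and small: "integral {a..b} total_rate \<le> 1/4"
    and cont: "\<And>i. i \<in> S \<Longrightarrow> continuous_on {a..b} (y i)"
    and super: "\<And>i r t. \<lbrakk>i \<in> S; a \<le> r; r \<le> t; t \<le> b\<rbrakk> \<Longrightarrow>
      integral {r..t} (\<lambda>s. \<Sum>j\<in>S. A s $ i $ j * (y j s - y i s)) \<le> y i t - y i r"
    and init: "\<And>i. i \<in> S \<Longrightarrow> 0 \<le> y i a"
    and "i0 \<in> S" "t0 \<in> {a..b}"
  shows "0 \<le> y i0 t0"
proof (rule ccontr)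
  assume neg: "\<not> 0 \<le> y i0 t0"
  have "\<forall>i. \<exists>m. i \<in> S \<longrightarrow> m \<in> {a..b} \<and> (\<forall>q\<in>{a..b}. y i m \<le> y i q)"
  proof
    fix i
    show "\<exists>m. i \<in> S \<longrightarrow> m \<in> {a..b} \<and> (\<forall>q\<in>{a..b}. y i m \<le> y i q)"
    proof (cases "i \<in> S")
      case True
      then have "\<exists>m\<in>{a..b}. \<forall>q\<in>{a..b}. y i m \<le> y i q"
        using \<open>a \<le> b\<close> by (intro continuous_attains_inf cont) auto
      then show ?thesis by blast
    qed simp
  qed
  from choice[OF this] obtain f where
    f: "\<And>i. i \<in> S \<Longrightarrow> f i \<in> {a..b}" "\<And>i q. i \<in> S \<Longrightarrow> q \<in> {a..b} \<Longrightarrow> y i (f i) \<le> y i q" by blast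
  define Z where "Z = (\<lambda>i. y i (f i)) ` S"
  have "finite Z" "Z \<noteq> {}" using \<open>i0 \<in> S\<close> by (auto simp: Z_def)
  then have "Min Z \<in> Z" by (rule Min_in)
  then obtain i where i: "i \<in> S" "Min Z = y i (f i)" by (metis Z_def imageE)
  define m where "m = f i"
  have m: "m \<in> {a..b}" using f i by (auto simp: m_def)
  have min: "y i m \<le> y j q" if "j \<in> S" "q \<in> {a..b}" for j q
  proof -
    have "Min Z \<le> y j (f j)" using \<open>finite Z\<close> that by (auto simp: Z_def)
    then show ?thesis using f(2)[OF that] i by (simp add: m_def)
  qed
  have ym: "y i m < 0" using min[OF assms(7,8)] neg by simp
  have cont_m: "continuous_on {q..m} (y i)" if "a \<le> q" for q
    by (rule continuous_on_subset[OF cont[OF i(1)]]) (use m that in auto)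
  have zero: "\<exists>z. q \<le> z \<and> z \<le> m \<and> y i z = 0" if "a \<le> q" "q \<le> m" "0 \<le> y i q" for q
    by (rule IVT2'[OF _ that(3) that(2) cont_m[OF that(1)]]) (use ym in simp)
  \<comment> \<open>The zeros of y_i up to m form a compact set; it is nonempty because y_i starts
    nonnegative and ends negative, so a last zero exists.\<close>
  define R where "R = {q \<in> {a..m}. y i q = 0}"
  have "closed R"
    unfolding R_def by (intro continuous_closed_preimage_constant cont_m) auto
  moreover have "bounded R"
    by (rule bounded_subset[of "{a..m}"]) (auto simp: R_def)
  ultimately have "compact R" by (simp add: compact_eq_bounded_closed)
  moreover have "R \<noteq> {}"
    using zero[of a] init[OF i(1)] m unfolding R_def by fastforce
  ultimately obtain z where z: "z \<in> R" "\<And>q. q \<in> R \<Longrightarrow> q \<le> z"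
    using compact_attains_sup[of R] by blast
  have z': "a \<le> z" "z \<le> m" "y i z = 0" using z by (auto simp: R_def)
  \<comment> \<open>A positive value after z would force a later zero on the way down to y_i(m) <
    0.\<close>
  have nonpos: "y i q \<le> 0" if "q \<in> {z..m}" for q
  proof (rule ccontr)
    assume *: "\<not> y i q \<le> 0"
    have "a \<le> q" "q \<le> m" "0 \<le> y i q" using that z' * by auto
    then obtain p where p: "q \<le> p" "p \<le> m" "y i p = 0" using zero by blast
    then have "p \<le> z" using z(2)[of p] that z' by (simp add: R_def)
    then have "q = z" using that p by auto
    then show False using * z' by simp
  qed
  have "integral {z..m} (\<lambda>s. total_rate s * y i m) \<le>
      integral {z..m} (\<lambda>s. \<Sum>j\<in>S. A s $ i $ j * (y j s - y i s))"
  proof (rule integral_le)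
    show "(\<lambda>s. total_rate s * y i m) integrable_on {z..m}"
      using assms(1) z' by (intro integrable_on_mult_left total_rate_integrable) auto
    show "(\<lambda>s. \<Sum>j\<in>S. A s $ i $ j * (y j s - y i s)) integrable_on {z..m}"
    proof (rule row_sum_integrable)
      fix j assume "j \<in> S"
      show "continuous_on {z..m} (\<lambda>s. y j s - y i s)"
        by (intro continuous_on_diff continuous_on_subset[OF cont[OF \<open>j \<in> S\<close>]]
            continuous_on_subset[OF cont[OF i(1)]]) (use z' m in auto)
    qed (use assms(1) z' in auto)
    fix s assume s: "s \<in> {z..m}"
    then have s0: "0 \<le> s" "s \<in> {a..b}" using assms(1) z' m by auto
    have "total_rate s * y i m \<le> (\<Sum>j\<in>S - {i}. A s $ i $ j) * y i m"
      using partial_row_le_total_rate[of s i "S - {i}"] ym by (intro mult_right_mono_neg) auto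
    also have "\<dots> = (\<Sum>j\<in>S - {i}. A s $ i $ j * y i m)"
      by (simp add: sum_distrib_right)
    also have "\<dots> \<le> (\<Sum>j\<in>S - {i}. A s $ i $ j * (y j s - y i s))"
    proof (intro sum_mono mult_left_mono)
      fix j assume "j \<in> S - {i}"
      then show "y i m \<le> y j s - y i s" "0 \<le> A s $ i $ j"
        using min[of j s] nonpos[OF s] s0 offdiag_nonneg[of s i j] by auto
    qed
    also have "\<dots> = (\<Sum>j\<in>S. A s $ i $ j * (y j s - y i s))"
      by (rule sum.mono_neutral_left) auto
    finally show "total_rate s * y i m \<le> (\<Sum>j\<in>S. A s $ i $ j * (y j s - y i s))" .
  qed
  also have "\<dots> \<le> y i m"
    using super[OF i(1), of z m] z' m by auto
  finally have "integral {z..m} total_rate * y i m \<le> y i m" by simp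
  moreover have "integral {z..m} total_rate \<le> 1/4"
  proof (rule order_trans[OF _ small])
    show "integral {z..m} total_rate \<le> integral {a..b} total_rate"
      using z' m assms(1)
      by (intro integral_subset_le total_rate_integrable) (auto simp: total_rate_nonneg)
  qed
  then have "1/4 * y i m \<le> integral {z..m} total_rate * y i m"
    using ym by (intro mult_right_mono_neg) auto
  ultimately show False using ym by simp
qed

lemma supersolution_nonneg:
  assumes "0 \<le> a" "a \<le> b"
    and cont: "\<And>i. i \<in> S \<Longrightarrow> continuous_on {a..b} (y i)"
    and super: "\<And>i r t. \<lbrakk>i \<in> S; a \<le> r; r \<le> t; t \<le> b\<rbrakk> \<Longrightarrow>
      integral {r..t} (\<lambda>s. \<Sum>j\<in>S. A s $ i $ j * (y j s - y i s)) \<le> y i t - y i r"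
    and init: "\<And>i. i \<in> S \<Longrightarrow> 0 \<le> y i a"
    and "i \<in> S"
  shows "0 \<le> y i b"
proof -
  \<comment> \<open>Propagation of nonnegativity from r to u, rather than nonnegativity itself, is
    transitive as \<open>interval_induct\<close> requires.\<close>
  define P where "P r u \<longleftrightarrow> u \<le> b \<longrightarrow> (\<forall>i\<in>S. 0 \<le> y i r) \<longrightarrow> (\<forall>i\<in>S. 0 \<le> y i u)" for r u
  have "P a b"
    using assms(1,2)
  proof (rule interval_induct)
    show "P r t" if "r \<le> s" "s \<le> t" "P r s" "P s t" for r s t
      using that by (auto simp: P_def)
    show "P r u" if "a \<le> r" "r \<le> u" "integral {r..u} total_rate \<le> 1/4" for r u
      unfolding P_def
    proof (intro impI ballI)
      fix i assume "u \<le> b" and r: "\<forall>i\<in>S. 0 \<le> y i r" and i: "i \<in> S"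
      show "0 \<le> y i u"
      proof (rule supersolution_nonneg_small[of r u S y])
        show "continuous_on {r..u} (y i)" if "i \<in> S" for i
          using \<open>a \<le> r\<close> \<open>u \<le> b\<close> by (intro continuous_on_subset[OF cont[OF that]]) auto
      qed (use that \<open>u \<le> b\<close> r i assms(1) super in auto)
    qed
  qed
  then show ?thesis using init \<open>i \<in> S\<close> by (auto simp: P_def)
qed

text \<open>Since the row sums of \<open>A\<close> vanish, subtracting x_i from every x_j does not
  change the right-hand side, and a trajectory satisfies the hypothesis of the minimum principle
  with equality.\<close>

lemma trajectory_nonneg:
  assumes "0 \<le> \<tau>" "\<tau> \<le> t" "\<And>i. 0 \<le> v $ i"
  shows "0 \<le> trajectory \<tau> v t $ i"
proof (rule supersolution_nonneg[of \<tau> t UNIV "\<lambda>i t. trajectory \<tau> v t $ i"])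
  show "continuous_on {\<tau>..t} (\<lambda>t. trajectory \<tau> v t $ i)" for i
    by (intro continuous_on_component trajectory_continuous assms)
  show "integral {r..q} (\<lambda>s. \<Sum>j\<in>UNIV. A s $ i $ j * (trajectory \<tau> v s $ j - trajectory \<tau> v s $ i))
      \<le> trajectory \<tau> v q $ i - trajectory \<tau> v r $ i" if "\<tau> \<le> r" "r \<le> q" for i r q
  proof -
    have "integral {r..q} (\<lambda>s. \<Sum>j\<in>UNIV. A s $ i $ j * (trajectory \<tau> v s $ j - trajectory \<tau> v s $ i))
        = integral {r..q} (\<lambda>s. \<Sum>j\<in>UNIV. A s $ i $ j * trajectory \<tau> v s $ j)"
    proof (rule Henstock_Kurzweil_Integration.integral_cong)
      fix s assume "s \<in> {r..q}"
      then have "(\<Sum>j\<in>UNIV. A s $ i $ j) = 0" using assms that by (intro row_sum) auto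
      then show "(\<Sum>j\<in>UNIV. A s $ i $ j * (trajectory \<tau> v s $ j - trajectory \<tau> v s $ i)) =
          (\<Sum>j\<in>UNIV. A s $ i $ j * trajectory \<tau> v s $ j)"
        by (simp add: right_diff_distrib sum_subtractf flip: sum_distrib_right)
    qed
    then show ?thesis
      using integral_unique[OF trajectory_increment[OF assms(1) that, of i v]] by simp
  qed
qed (use assms trajectory_solves(2) in auto)

section \<open>Entries of the transition matrix\<close>

lemma transition_entry: "state_transition A t \<tau> $ i $ j = trajectory \<tau> (axis j 1) t $ i"
  by (simp add: trajectory_def matrix_vector_mul_component inner_axis)

lemma transition_nonneg:
  assumes "0 \<le> \<tau>" "\<tau> \<le> t"
  shows "0 \<le> state_transition A t \<tau> $ i $ j"
  unfolding transition_entry using assms by (intro trajectory_nonneg) (auto simp: axis_def)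

lemma transition_row_sum:
  assumes "0 \<le> \<tau>" "\<tau> \<le> t"
  shows "(\<Sum>j\<in>UNIV. state_transition A t \<tau> $ i $ j) = 1"
proof -
  have "trajectory \<tau> 1 t $ i = 1" using trajectory_one[OF assms] by simp
  then show ?thesis by (simp add: trajectory_def matrix_vector_mult_def)
qed

lemma transition_le_one:
  assumes "0 \<le> \<tau>" "\<tau> \<le> t"
  shows "state_transition A t \<tau> $ i $ j \<le> 1"
  using member_le_sum[of j UNIV "\<lambda>j. state_transition A t \<tau> $ i $ j"] transition_nonneg[OF assms]
    transition_row_sum[OF assms, of i] by simp

lemma trajectory_component:
  "trajectory \<tau> v t $ i = (\<Sum>j\<in>UNIV. state_transition A t \<tau> $ i $ j * v $ j)"
  by (simp add: trajectory_def matrix_vector_mult_def)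

lemma trajectory_abs_le:
  assumes "0 \<le> \<tau>" "\<tau> \<le> t" "\<And>j. \<bar>v $ j\<bar> \<le> M"
  shows "\<bar>trajectory \<tau> v t $ i\<bar> \<le> M"
proof -
  have "\<bar>trajectory \<tau> v t $ i\<bar> \<le> (\<Sum>j\<in>UNIV. \<bar>state_transition A t \<tau> $ i $ j * v $ j\<bar>)"
    unfolding trajectory_component by (rule sum_abs)
  also have "\<dots> \<le> (\<Sum>j\<in>UNIV. state_transition A t \<tau> $ i $ j * M)"
    using assms transition_nonneg[OF assms(1,2)]
    by (intro sum_mono) (simp add: abs_mult mult_left_mono)
  also have "\<dots> = M"
    using transition_row_sum[OF assms(1,2), of i] by (simp flip: sum_distrib_right)
  finally show ?thesis .
qed

text \<open>Column j of the transition matrix is the trajectory u starting at the j-th unit vector.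
  On a short interval u_j stays above 3/4 and so feeds u_i at rate at least 3/4 of a_ij, while the
  diagonal term can remove only a small part of what u_i has gained.\<close>

lemma transition_entry_lower_bound:
  assumes "0 \<le> s" "s \<le> t" and small: "integral {s..t} total_rate \<le> 1/4" and "i \<noteq> j"
  shows "1/2 * integral {s..t} (\<lambda>r. A r $ i $ j) \<le> state_transition A t s $ i $ j"
proof -
  define u where "u k q = trajectory s (axis j 1) q $ k" for k q
  have u01: "0 \<le> u k q" "u k q \<le> 1" if "s \<le> q" for k q
    using transition_nonneg[OF assms(1) that, of k j] transition_le_one[OF assms(1) that, of k j]
    by (auto simp: transition_entry u_def)
  have cont: "continuous_on {s..t} (u k)" for k
    unfolding u_def by (intro continuous_on_component trajectory_continuous assms)
  have inc: "((\<lambda>r. \<Sum>l\<in>UNIV. A r $ k $ l * u l r) has_integral (u k q - u k p)) {p..q}"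
    if "s \<le> p" "p \<le> q" for k p q
    unfolding u_def using trajectory_increment[OF assms(1) that] .
  have small': "integral {p..q} total_rate \<le> 1/4" if "s \<le> p" "q \<le> t" for p q
    using that assms(1)
    by (intro order_trans[OF integral_subset_le small] total_rate_integrable)
      (auto simp: total_rate_nonneg)
  have diag: "- (total_rate r * w) \<le> A r $ k $ k * u k r" if "s \<le> r" "u k r \<le> w" for k r w
  proof -
    have "- (A r $ k $ k * u k r) \<le> \<bar>A r $ k $ k\<bar> * u k r"
      using u01(1)[OF that(1), of k] by (metis abs_ge_minus_self minus_mult_left mult_right_mono)
    also have "\<dots> \<le> total_rate r * w"
      using u01(1)[OF that(1), of k] that(2)
      by (intro mult_mono entry_abs_le_total_rate total_rate_nonneg) auto
    finally show ?thesis by simp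
  qed
  \<comment> \<open>Off-diagonal terms only increase u_k, so its loss is at most the integrated
    total rate times an upper bound w of u_k.\<close>
  have decr: "u k p - w / 4 \<le> u k q"
    if pq: "s \<le> p" "p \<le> q" "q \<le> t" and w: "\<And>r. r \<in> {p..q} \<Longrightarrow> u k r \<le> w" "0 \<le> w" for k p q w
  proof -
    have "integral {p..q} (\<lambda>r. - (total_rate r * w)) \<le>
        integral {p..q} (\<lambda>r. \<Sum>l\<in>UNIV. A r $ k $ l * u l r)"
    proof (rule integral_le)
      show "(\<lambda>r. - (total_rate r * w)) integrable_on {p..q}"
        using assms pq by (intro integrable_neg integrable_on_mult_left total_rate_integrable) auto
      show "(\<lambda>r. \<Sum>l\<in>UNIV. A r $ k $ l * u l r) integrable_on {p..q}"
        using inc[OF pq(1,2)] by blast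
      fix r assume r: "r \<in> {p..q}"
      have "- (total_rate r * w) \<le> A r $ k $ k * u k r"
        using diag[of r k w] r pq w by auto
      also have "\<dots> \<le> A r $ k $ k * u k r + (\<Sum>l\<in>UNIV - {k}. A r $ k $ l * u l r)"
      proof -
        have "0 \<le> (\<Sum>l\<in>UNIV - {k}. A r $ k $ l * u l r)"
          using r pq assms by (intro sum_nonneg mult_nonneg_nonneg offdiag_nonneg u01) auto
        then show ?thesis by simp
      qed
      also have "\<dots> = (\<Sum>l\<in>UNIV. A r $ k $ l * u l r)"
        by (simp add: sum.remove[of UNIV k])
      finally show "- (total_rate r * w) \<le> (\<Sum>l\<in>UNIV. A r $ k $ l * u l r)" .
    qed
    also have "\<dots> = u k q - u k p"
      using inc[OF pq(1,2)] by (rule integral_unique)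
    finally have "- (integral {p..q} total_rate * w) \<le> u k q - u k p" by simp
    moreover have "integral {p..q} total_rate * w \<le> 1/4 * w"
      using small'[OF pq(1,3)] w(2) by (intro mult_right_mono) auto
    ultimately show ?thesis by simp
  qed
  have start: "u j s = 1" "u i s = 0"
    using \<open>i \<noteq> j\<close> trajectory_solves(2)[OF assms(1)] by (simp_all add: u_def axis_def)
  have uj: "3/4 \<le> u j r" if "r \<in> {s..t}" for r
    using decr[of s r j 1] that u01(2)[of _ j] start by auto
  obtain m where m: "m \<in> {s..t}" "\<And>r. r \<in> {s..t} \<Longrightarrow> u i r \<le> u i m"
    using continuous_attains_sup[OF _ _ cont[of i]] assms(2) by auto
  \<comment> \<open>Using the bound 1 for u_i would cost a fixed 1/4 however small the flow is; its
    maximum w yields a loss that can be absorbed into u_i(t).\<close>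
  define w where "w = u i m"
  have w0: "0 \<le> w" using u01 m by (simp add: w_def)
  have "w - w / 4 \<le> u i t"
    using decr[of m t i w] m w0 by (auto simp: w_def)
  moreover have "integral {s..t} (\<lambda>r. 3/4 * A r $ i $ j - total_rate r * w) \<le>
      integral {s..t} (\<lambda>r. \<Sum>l\<in>UNIV. A r $ i $ l * u l r)"
  proof (rule integral_le)
    show "(\<lambda>r. 3/4 * A r $ i $ j - total_rate r * w) integrable_on {s..t}"
      using assms by (intro integrable_diff integrable_on_mult_left integrable_on_mult_right
          total_rate_integrable entry_integrable)
    show "(\<lambda>r. \<Sum>l\<in>UNIV. A r $ i $ l * u l r) integrable_on {s..t}"
      using inc[of s t i] assms by blast
    fix r assume r: "r \<in> {s..t}"
    then have r0: "0 \<le> r" "s \<le> r" using assms by auto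
    have "3/4 * A r $ i $ j \<le> A r $ i $ j * u j r"
      using mult_left_mono[OF uj[OF r] offdiag_nonneg[OF r0(1) \<open>i \<noteq> j\<close>]] by simp
    moreover have "- (total_rate r * w) \<le> A r $ i $ i * u i r"
      using diag[OF r0(2), of i w] m(2)[OF r] by (simp add: w_def)
    moreover have "0 \<le> (\<Sum>l\<in>UNIV - {i} - {j}. A r $ i $ l * u l r)"
      using r0 by (intro sum_nonneg mult_nonneg_nonneg offdiag_nonneg u01) auto
    moreover have "(\<Sum>l\<in>UNIV. A r $ i $ l * u l r) =
        A r $ i $ i * u i r + (A r $ i $ j * u j r + (\<Sum>l\<in>UNIV - {i} - {j}. A r $ i $ l * u l r))"
      using \<open>i \<noteq> j\<close> by (simp add: sum.remove[of UNIV i] sum.remove[of "UNIV - {i}" j])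
    ultimately show "3/4 * A r $ i $ j - total_rate r * w \<le> (\<Sum>l\<in>UNIV. A r $ i $ l * u l r)"
      by linarith
  qed
  moreover have "integral {s..t} (\<lambda>r. \<Sum>l\<in>UNIV. A r $ i $ l * u l r) = u i t"
    using integral_unique[OF inc[of s t i]] assms start by simp
  moreover have "integral {s..t} (\<lambda>r. 3/4 * A r $ i $ j - total_rate r * w) =
      3/4 * integral {s..t} (\<lambda>r. A r $ i $ j) - integral {s..t} total_rate * w"
    using assms by (subst Henstock_Kurzweil_Integration.integral_diff)
      (auto intro!: integrable_on_mult_left integrable_on_mult_right total_rate_integrable entry_integrable)
  moreover have "integral {s..t} total_rate * w \<le> 1/4 * w"
    using small w0 by (intro mult_right_mono) auto
  moreover have "0 \<le> integral {s..t} (\<lambda>r. A r $ i $ j)"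
    using assms by (intro Henstock_Kurzweil_Integration.integral_nonneg entry_integrable offdiag_nonneg) auto
  \<comment> \<open>With I the integral of a_ij, 3w/4 \<le> u_i(t) and 3I/4 - w/4 \<le> u_i(t) give
    u_i(t) \<ge> 9I/16, and I \<ge> 0 allows 1/2 instead.\<close>
  ultimately have "1/2 * integral {s..t} (\<lambda>r. A r $ i $ j) \<le> u i t" by linarith
  then show ?thesis by (simp add: u_def transition_entry)
qed

end

section \<open>Oscillation of bounded functions\<close>

lemma antimono_convergent_at_top:
  fixes F :: "real \<Rightarrow> real"
  assumes anti: "\<And>s t. a \<le> s \<Longrightarrow> s \<le> t \<Longrightarrow> F t \<le> F s"
    and lower: "\<And>t. a \<le> t \<Longrightarrow> B \<le> F t"
  shows "\<exists>l. (F \<longlongrightarrow> l) at_top"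
proof -
  define l where "l = Inf (F ` {a..})"
  have bdd: "bdd_below (F ` {a..})" using lower by (intro bdd_belowI[of _ B]) auto
  have "(F \<longlongrightarrow> l) at_top"
  proof (rule decreasing_tendsto)
    show "\<forall>\<^sub>F t in at_top. l \<le> F t"
      unfolding l_def using eventually_ge_at_top[of a]
      by eventually_elim (use bdd in \<open>auto intro: cInf_lower\<close>)
    fix y assume "l < y"
    then obtain s where s: "a \<le> s" "F s < y"
      unfolding l_def using cInf_lessD[of "F ` {a..}" y] by auto
    show "\<forall>\<^sub>F t in at_top. F t < y"
      using eventually_ge_at_top[of s] by eventually_elim (use anti s in fastforce)
  qed
  then show ?thesis ..
qed

text \<open>Without a limit the lower and upper limits differ. Two values strictly between them are
  passed in both directions at arbitrarily late times, and the intermediate value theorem catches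
  every level in between.\<close>

lemma bounded_oscillation:
  fixes u :: "real \<Rightarrow> real"
  assumes cont: "\<And>t. continuous_on {a..t} u" and bound: "\<And>t. a \<le> t \<Longrightarrow> \<bar>u t\<bar> \<le> B"
    and no_limit: "\<nexists>l. (u \<longlongrightarrow> l) at_top"
  shows "\<exists>\<alpha> \<beta>. \<alpha> < \<beta> \<and> (\<forall>c\<in>{\<alpha>..\<beta>}. \<exists>\<^sub>F t in at_top. u t = c)"
proof -
  define m M where "m = Liminf at_top (\<lambda>t. ereal (u t))" and "M = Limsup at_top (\<lambda>t. ereal (u t))"
  have "m \<le> M" unfolding m_def M_def by (rule Liminf_le_Limsup) simp
  have ev: "\<forall>\<^sub>F t in at_top. \<bar>u t\<bar> \<le> B"
    using eventually_ge_at_top[of a] by eventually_elim (rule bound)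
  have "ereal (- B) \<le> m" unfolding m_def
    by (rule Liminf_bounded) (use ev in \<open>auto elim!: eventually_mono\<close>)
  moreover have "M \<le> ereal B" unfolding M_def
    by (rule Limsup_bounded) (use ev in \<open>auto elim!: eventually_mono\<close>)
  ultimately have fin: "\<bar>m\<bar> \<noteq> \<infinity>" using \<open>m \<le> M\<close> by auto
  have "m \<noteq> M"
  proof
    assume "m = M"
    then have "((\<lambda>t. ereal (u t)) \<longlongrightarrow> m) at_top"
      by (intro tendsto_iff_Liminf_eq_Limsup[THEN iffD2]) (simp_all add: m_def M_def)
    then have "(u \<longlongrightarrow> real_of_ereal m) at_top"
      using fin by (simp flip: lim_ereal add: ereal_real')
    then show False using no_limit by blast
  qed
  then have "m < M" using \<open>m \<le> M\<close> by simp
  then obtain \<alpha> where \<alpha>: "m < ereal \<alpha>" "ereal \<alpha> < M" using ereal_dense2 by blast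
  then obtain \<beta> where \<beta>: "ereal \<alpha> < ereal \<beta>" "ereal \<beta> < M" using ereal_dense2 by blast
  have low: "\<exists>\<^sub>F t in at_top. u t < \<alpha>"
  proof (rule ccontr)
    assume "\<not> ?thesis"
    then have "ereal \<alpha> \<le> m" unfolding m_def
      by (intro Liminf_bounded) (simp add: not_frequently not_less)
    then show False using \<alpha> by simp
  qed
  have high: "\<exists>\<^sub>F t in at_top. \<beta> < u t"
  proof (rule ccontr)
    assume "\<not> ?thesis"
    then have "M \<le> ereal \<beta>" unfolding M_def
      by (intro Limsup_bounded) (simp add: not_frequently not_less)
    then show False using \<beta> by simp
  qed
  have "\<exists>\<^sub>F t in at_top. u t = c" if c: "c \<in> {\<alpha>..\<beta>}" for c
    unfolding frequently_def
  proof
    assume "\<forall>\<^sub>F t in at_top. u t \<noteq> c"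
    then obtain T where T: "\<And>t. T \<le> t \<Longrightarrow> u t \<noteq> c" by (auto simp: eventually_at_top_linorder)
    obtain t1 where t1: "max a T \<le> t1" "u t1 < \<alpha>"
      using low unfolding frequently_def eventually_at_top_linorder by blast
    obtain t2 where t2: "max a T \<le> t2" "\<beta> < u t2"
      using high unfolding frequently_def eventually_at_top_linorder by blast
    have "\<exists>z\<ge>T. u z = c"
    proof (cases "t1 \<le> t2")
      case True
      have "\<exists>z\<ge>t1. z \<le> t2 \<and> u z = c"
        by (rule IVT'[OF _ _ True continuous_on_subset[OF cont[of t2]]]) (use t1 t2 c in auto)
      then obtain z where "t1 \<le> z" "u z = c" by blast
      then show ?thesis using t1(1) by (intro exI[of _ z]) simp
    next
      case False
      then have le: "t2 \<le> t1" by simp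
      have "\<exists>z\<ge>t2. z \<le> t1 \<and> u z = c"
        by (rule IVT2'[OF _ _ le continuous_on_subset[OF cont[of t1]]]) (use t1 t2 c in auto)
      then obtain z where "t2 \<le> z" "u z = c" by blast
      then show ?thesis using t2(1) by (intro exI[of _ z]) simp
    qed
    then show False using T by blast
  qed
  moreover have "\<alpha> < \<beta>" using \<beta>(1) by simp
  ultimately show ?thesis by blast
qed

context ct_chain
begin

text \<open>Translates the extended nonnegative integral over the half-line into integrals over
  compact intervals. A uniform bound for these passes to the half-line by monotone convergence along
  {0..n}.\<close>

lemma infinite_flow_edge_iff:
  assumes "i \<noteq> j"
  shows "(i, j) \<in> infinite_flow_edges A \<longleftrightarrow>
    \<not> (\<exists>B. \<forall>t\<ge>0. integral {0..t} (\<lambda>s. A s $ i $ j + A s $ j $ i) \<le> B)"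
proof -
  define f where "f s = A s $ i $ j + A s $ j $ i" for s
  have nonneg: "0 \<le> f s" if "0 \<le> s" for s
    using offdiag_nonneg[OF that] assms by (auto simp: f_def)
  have int: "(f has_integral integral {0..t} f) {0..t}" for t
    unfolding f_def by (intro integrable_integral integrable_add entry_integrable) auto
  have nn: "(\<integral>\<^sup>+s. ennreal (f s) * indicator {0..t} s \<partial>lebesgue) = ennreal (integral {0..t} f)" for t
    unfolding nn_integral_completion
    by (rule nn_integral_has_integral_lebesgue'[OF _ int]) (use nonneg in auto)
  define I where "I = (\<integral>\<^sup>+s. ennreal (f s) * indicator {0..} s \<partial>lebesgue)"
  have "I < \<infinity> \<longleftrightarrow> (\<exists>B. \<forall>t\<ge>0. integral {0..t} f \<le> B)"
  proof
    assume "I < \<infinity>"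
    then obtain B where B: "I = ennreal B" "0 \<le> B" by (cases I) auto
    have "integral {0..t} f \<le> B" for t
    proof -
      have "ennreal (integral {0..t} f) \<le> I"
        unfolding nn[symmetric] I_def by (intro nn_integral_mono) (auto simp: indicator_def)
      then show ?thesis using B by simp
    qed
    then show "\<exists>B. \<forall>t\<ge>0. integral {0..t} f \<le> B" by blast
  next
    assume "\<exists>B. \<forall>t\<ge>0. integral {0..t} f \<le> B"
    then obtain B where B: "\<And>t. 0 \<le> t \<Longrightarrow> integral {0..t} f \<le> B" by blast
    define g where "g n s = ennreal (f s) * indicator {0..real n} s" for n s
    have "I \<le> (\<integral>\<^sup>+s. (SUP n. g n s) \<partial>lebesgue)"
      unfolding I_def
    proof (rule nn_integral_mono)
      fix s
      obtain n where n: "s \<le> real n" using real_arch_simple by blast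
      have "ennreal (f s) * indicator {0..} s \<le> g n s"
        using n by (auto simp: g_def indicator_def)
      also have "\<dots> \<le> (SUP n. g n s)" by (rule SUP_upper) simp
      finally show "ennreal (f s) * indicator {0..} s \<le> (SUP n. g n s)" .
    qed
    also have "\<dots> = (SUP n. \<integral>\<^sup>+s. g n s \<partial>lebesgue)"
    proof (rule nn_integral_monotone_convergence_SUP)
      show "incseq g" by (auto simp: incseq_def le_fun_def g_def indicator_def)
      fix n
      have "(\<lambda>s. indicator {0..real n} s *\<^sub>R f s) \<in> borel_measurable lebesgue"
        by (rule has_integral_implies_lebesgue_measurable[OF int])
      then have "(\<lambda>s. ennreal (indicator {0..real n} s *\<^sub>R f s)) \<in> borel_measurable lebesgue"
        by measurable
      also have "(\<lambda>s. ennreal (indicator {0..real n} s *\<^sub>R f s)) = g n"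
        by (auto simp: g_def indicator_def fun_eq_iff)
      finally show "g n \<in> borel_measurable lebesgue" .
    qed
    also have "\<dots> \<le> ennreal B"
      unfolding g_def nn by (intro SUP_least ennreal_leI B) simp
    finally show "I < \<infinity>" by (rule order_le_less_trans) simp
  qed
  moreover have "(i, j) \<in> infinite_flow_edges A \<longleftrightarrow> I = \<infinity>"
    using assms by (simp add: infinite_flow_edges_def I_def f_def)
  moreover have "I = \<infinity> \<longleftrightarrow> \<not> I < \<infinity>"
    by (simp add: less_top[symmetric])
  ultimately show ?thesis unfolding f_def by blast
qed

lemma infinite_flow_edges_sym: "sym (infinite_flow_edges A)"
  by (auto simp: sym_def infinite_flow_edges_def add.commute)

end

section \<open>Convergence and dissipation in Class P*\<close>

locale p_star_chain = ct_chain A for A :: "real \<Rightarrow> real ^ 'n ^ 'n" +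
  fixes \<pi> :: "real \<Rightarrow> real ^ 'n" and p :: real
  assumes absolute_probability: "absolute_probability_sequence A \<pi>"
    and p_pos: "0 < p"
    and p_less: "0 \<le> t \<Longrightarrow> p < \<pi> t $ i"
begin

section \<open>Averages weighted by the absolute probability sequence\<close>

lemma pi_nonneg: "0 \<le> t \<Longrightarrow> 0 \<le> \<pi> t $ i"
  using p_less[of t i] p_pos by simp

lemma pi_sum: "0 \<le> t \<Longrightarrow> (\<Sum>i\<in>UNIV. \<pi> t $ i) = 1"
  using absolute_probability by (simp add: absolute_probability_sequence_def stochastic_vector_def)

lemma pi_transition:
  assumes "0 \<le> s" "s \<le> t"
  shows "\<pi> s $ j = (\<Sum>i\<in>UNIV. \<pi> t $ i * state_transition A t s $ i $ j)"
proof -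
  have "\<pi> s = \<pi> t v* state_transition A t s"
    using absolute_probability assms by (simp add: absolute_probability_sequence_def)
  then show ?thesis by (simp add: vector_matrix_mult_def mult.commute)
qed

text \<open>The tower property: it moves an average at time s to time t, where rows of the
  transition matrix can be compared one by one.\<close>

lemma pi_transition_sum:
  assumes "0 \<le> s" "s \<le> t"
  shows "(\<Sum>j\<in>UNIV. \<pi> s $ j * g j) =
    (\<Sum>i\<in>UNIV. \<pi> t $ i * (\<Sum>j\<in>UNIV. state_transition A t s $ i $ j * g j))"
proof -
  have "(\<Sum>j\<in>UNIV. \<pi> s $ j * g j) =
      (\<Sum>j\<in>UNIV. \<Sum>i\<in>UNIV. \<pi> t $ i * state_transition A t s $ i $ j * g j)"
    by (simp add: pi_transition[OF assms] sum_distrib_right)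
  also have "\<dots> = (\<Sum>i\<in>UNIV. \<Sum>j\<in>UNIV. \<pi> t $ i * state_transition A t s $ i $ j * g j)"
    by (rule sum.swap)
  finally show ?thesis by (simp add: sum_distrib_left mult.assoc)
qed

lemma mean_deviation_antimono:
  assumes "0 \<le> \<tau>" "\<tau> \<le> s" "s \<le> t"
  shows "(\<Sum>i\<in>UNIV. \<pi> t $ i * \<bar>trajectory \<tau> v t $ i - c\<bar>) \<le>
    (\<Sum>i\<in>UNIV. \<pi> s $ i * \<bar>trajectory \<tau> v s $ i - c\<bar>)"
proof -
  have st: "0 \<le> s" "s \<le> t" using assms by auto
  have "\<bar>trajectory \<tau> v t $ i - c\<bar> \<le>
      (\<Sum>j\<in>UNIV. state_transition A t s $ i $ j * \<bar>trajectory \<tau> v s $ j - c\<bar>)" for i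
  proof -
    have "trajectory \<tau> v t $ i - c =
        (\<Sum>j\<in>UNIV. state_transition A t s $ i $ j * (trajectory \<tau> v s $ j - c))"
      unfolding trajectory_semigroup[OF assms, symmetric] trajectory_component[of s]
      using transition_row_sum[OF st, of i]
      by (simp add: right_diff_distrib sum_subtractf flip: sum_distrib_right)
    then show ?thesis
      using sum_abs[of "\<lambda>j. state_transition A t s $ i $ j * (trajectory \<tau> v s $ j - c)" UNIV]
        transition_nonneg[OF st] by (simp add: abs_mult)
  qed
  then show ?thesis
    unfolding pi_transition_sum[OF st] using pi_nonneg assms
    by (intro sum_mono mult_left_mono) auto
qed

text \<open>Row i of the transition matrix is a probability vector under which x(s) has mean x_i(t).
  The inner sum is therefore a variance, that is, a second moment minus the squared mean, and the
  tower property turns the averaged second moments into the energy at time s.\<close>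

lemma energy_dissipation_identity:
  assumes "0 \<le> \<tau>" "\<tau> \<le> s" "s \<le> t"
  shows "(\<Sum>i\<in>UNIV. \<pi> s $ i * (trajectory \<tau> v s $ i)\<^sup>2) - (\<Sum>i\<in>UNIV. \<pi> t $ i * (trajectory \<tau> v t $ i)\<^sup>2)
    = (\<Sum>i\<in>UNIV. \<pi> t $ i * (\<Sum>j\<in>UNIV.
        state_transition A t s $ i $ j * (trajectory \<tau> v s $ j - trajectory \<tau> v t $ i)\<^sup>2))"
proof -
  have st: "0 \<le> s" "s \<le> t" using assms by auto
  have "(\<Sum>j\<in>UNIV. state_transition A t s $ i $ j * (trajectory \<tau> v s $ j - trajectory \<tau> v t $ i)\<^sup>2)
      = (\<Sum>j\<in>UNIV. state_transition A t s $ i $ j * (trajectory \<tau> v s $ j)\<^sup>2) - (trajectory \<tau> v t $ i)\<^sup>2"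
    for i
  proof -
    define y where "y = trajectory \<tau> v t $ i"
    have y: "(\<Sum>j\<in>UNIV. state_transition A t s $ i $ j * trajectory \<tau> v s $ j) = y"
      unfolding y_def trajectory_semigroup[OF assms, symmetric] trajectory_component[of s] ..
    have "(\<Sum>j\<in>UNIV. state_transition A t s $ i $ j * (trajectory \<tau> v s $ j - y)\<^sup>2) =
        (\<Sum>j\<in>UNIV. state_transition A t s $ i $ j * (trajectory \<tau> v s $ j)\<^sup>2
          - (state_transition A t s $ i $ j * trajectory \<tau> v s $ j) * (2 * y)
          + state_transition A t s $ i $ j * y\<^sup>2)"
      by (intro sum.cong) (auto simp: power2_eq_square algebra_simps)
    also have "\<dots> = (\<Sum>j\<in>UNIV. state_transition A t s $ i $ j * (trajectory \<tau> v s $ j)\<^sup>2) - y * (2 * y) + y\<^sup>2"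
      using transition_row_sum[OF st, of i]
      by (simp add: sum.distrib sum_subtractf y flip: sum_distrib_right)
    finally show ?thesis unfolding y_def by (simp add: power2_eq_square)
  qed
  then show ?thesis
    by (simp add: pi_transition_sum[OF st] right_diff_distrib sum_subtractf)
qed

lemma trajectory_component_convergent:
  assumes "0 \<le> \<tau>"
  shows "\<exists>l. ((\<lambda>t. trajectory \<tau> v t $ i) \<longlongrightarrow> l) at_top"
proof (rule ccontr)
  assume no_limit: "\<not> ?thesis"
  define x where "x t = trajectory \<tau> v t" for t
  define F where "F c t = (\<Sum>k\<in>UNIV. \<pi> t $ k * \<bar>x t $ k - c\<bar>)" for c t
  have "\<exists>l. (F c \<longlongrightarrow> l) at_top" for c
  proof (rule antimono_convergent_at_top[of \<tau> _ 0])
    show "F c t \<le> F c s" if "\<tau> \<le> s" "s \<le> t" for s t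
      unfolding F_def x_def by (rule mean_deviation_antimono[OF assms that])
    show "0 \<le> F c t" if "\<tau> \<le> t" for t
      unfolding F_def using pi_nonneg[of t] that assms by (intro sum_nonneg) auto
  qed
  then have "\<forall>c. \<exists>l. (F c \<longlongrightarrow> l) at_top" by blast
  from choice[OF this] obtain f where f: "\<And>c. (F c \<longlongrightarrow> f c) at_top" by blast
  have lipschitz: "f c - f d \<le> \<bar>c - d\<bar>" for c d
  proof (rule tendsto_upperbound[OF tendsto_diff[OF f f]])
    show "\<forall>\<^sub>F t in at_top. F c t - F d t \<le> \<bar>c - d\<bar>"
      using eventually_ge_at_top[of 0]
    proof eventually_elim
      fix t :: real assume t: "0 \<le> t"
      have "F c t - F d t = (\<Sum>k\<in>UNIV. \<pi> t $ k * (\<bar>x t $ k - c\<bar> - \<bar>x t $ k - d\<bar>))"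
        by (simp add: F_def right_diff_distrib sum_subtractf)
      also have "\<dots> \<le> (\<Sum>k\<in>UNIV. \<pi> t $ k * \<bar>c - d\<bar>)"
        using pi_nonneg[OF t] by (intro sum_mono mult_left_mono) auto
      also have "\<dots> = \<bar>c - d\<bar>" using pi_sum[OF t] by (simp flip: sum_distrib_right)
      finally show "F c t - F d t \<le> \<bar>c - d\<bar>" .
    qed
  qed simp
  obtain \<alpha> \<beta> where \<alpha>\<beta>: "\<alpha> < \<beta>" "\<And>c. c \<in> {\<alpha>..\<beta>} \<Longrightarrow> \<exists>\<^sub>F t in at_top. x t $ i = c"
  proof -
    have "\<bar>v $ j\<bar> \<le> norm v" for j by (rule component_le_norm_cart)
    then have "\<bar>x t $ i\<bar> \<le> norm v" if "\<tau> \<le> t" for t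
      unfolding x_def using trajectory_abs_le[OF assms that] by blast
    moreover have "continuous_on {\<tau>..t} (\<lambda>t. x t $ i)" for t
      unfolding x_def by (intro continuous_on_component trajectory_continuous assms)
    ultimately have "\<exists>\<alpha> \<beta>. \<alpha> < \<beta> \<and> (\<forall>c\<in>{\<alpha>..\<beta>}. \<exists>\<^sub>F t in at_top. x t $ i = c)"
      using no_limit by (intro bounded_oscillation) (auto simp: x_def)
    then show ?thesis using that by blast
  qed
  \<comment> \<open>The second difference of |y - c| with step h is nonnegative by convexity and
    equals 2h at y = c. Hence at every visit of x_i to c the second difference of \<open>F\<close>
    is at least 2 p h; a smaller limit would exclude late visits.\<close>
  have kink: "2 * p * h \<le> f (c + h) + f (c - h) - 2 * f c" if c: "c \<in> {\<alpha>..\<beta>}" and h: "0 \<le> h" for c h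
  proof (rule ccontr)
    assume "\<not> ?thesis"
    moreover have "((\<lambda>t. F (c + h) t + F (c - h) t - 2 * F c t) \<longlongrightarrow> f (c + h) + f (c - h) - 2 * f c) at_top"
      by (intro tendsto_intros f)
    ultimately have "\<forall>\<^sub>F t in at_top. F (c + h) t + F (c - h) t - 2 * F c t < 2 * p * h"
      by (intro order_tendstoD(2)) auto
    then have "\<forall>\<^sub>F t in at_top. x t $ i \<noteq> c"
      using eventually_ge_at_top[of 0]
    proof eventually_elim
      fix t :: real assume less: "F (c + h) t + F (c - h) t - 2 * F c t < 2 * p * h" and t: "0 \<le> t"
      define D where "D k = \<bar>x t $ k - (c + h)\<bar> + \<bar>x t $ k - (c - h)\<bar> - 2 * \<bar>x t $ k - c\<bar>" for k
      have "F (c + h) t + F (c - h) t - 2 * F c t = (\<Sum>k\<in>UNIV. \<pi> t $ k * D k)"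
        by (simp add: F_def D_def sum.distrib sum_subtractf sum_distrib_left algebra_simps)
      moreover have "0 \<le> D k" for k
        by (auto simp: D_def abs_if)
      then have "\<pi> t $ i * D i \<le> (\<Sum>k\<in>UNIV. \<pi> t $ k * D k)"
        using pi_nonneg[OF t] by (intro member_le_sum mult_nonneg_nonneg) auto
      moreover have "2 * p * h \<le> \<pi> t $ i * D i" if "x t $ i = c"
        using that h p_less[OF t, of i] mult_right_mono[of p "\<pi> t $ i" "2 * h"]
        by (simp add: D_def mult_ac)
      ultimately show "x t $ i \<noteq> c" using less by linarith
    qed
    then show False using \<alpha>\<beta>(2)[OF c] by (simp add: frequently_def)
  qed
  \<comment> \<open>K kinks raise the increments of f over one grid step by 2 p h K in total, while
    the Lipschitz bound confines each increment to [-h, h]; so K p > 1 is contradictory. Dividing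
    \<beta> - \<alpha> into K + 1 steps puts the K inner grid points in [\<alpha>, \<beta>].\<close>
  obtain K :: nat where K: "1 < real K * p" using reals_Archimedean3[OF p_pos] by blast
  define h where "h = (\<beta> - \<alpha>) / real (K + 1)"
  have h: "0 < h" using \<alpha>\<beta>(1) by (simp add: h_def)
  define c where "c k = \<alpha> + real k * h" for k
  have slope: "f (c 1) - f (c 0) + 2 * p * h * real k \<le> f (c (Suc k)) - f (c k)" if "k \<le> K" for k
    using that
  proof (induction k)
    case (Suc k)
    have "real (Suc k) * h \<le> real (K + 1) * h"
      using Suc.prems h by (intro mult_right_mono) auto
    also have "\<dots> = \<beta> - \<alpha>" by (simp add: h_def)
    finally have "c (Suc k) \<in> {\<alpha>..\<beta>}" using h by (simp add: c_def)
    then have "2 * p * h \<le> f (c (Suc k) + h) + f (c (Suc k) - h) - 2 * f (c (Suc k))"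
      using h by (intro kink) auto
    moreover have "c (Suc k) + h = c (Suc (Suc k))" "c (Suc k) - h = c k"
      by (simp_all add: c_def algebra_simps)
    ultimately show ?case using Suc by (simp add: algebra_simps)
  qed simp
  have "f (c (Suc K)) - f (c K) \<le> h" "f (c 0) - f (c 1) \<le> h"
    using lipschitz[of "c (Suc K)" "c K"] lipschitz[of "c 0" "c 1"] h
    by (simp_all add: c_def algebra_simps)
  then have "2 * p * h * real K \<le> 2 * h" using slope[of K] by linarith
  then have "(real K * p) * h \<le> 1 * h" by (simp add: mult_ac)
  then show False using K h by simp
qed

text \<open>If the limits differ, then x_j(s) and x_i(t) stay apart for all late s and t, even at
  different times, as the variance between two times requires. Each unit of flow a_ij then costs a
  fixed amount of energy, and the energy is nonnegative.\<close>

lemma limits_agree_on_positive_flow: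
  assumes "0 \<le> \<tau>" "i \<noteq> j"
    and lim: "((\<lambda>t. trajectory \<tau> v t $ i) \<longlongrightarrow> a) at_top" "((\<lambda>t. trajectory \<tau> v t $ j) \<longlongrightarrow> b) at_top"
    and "a \<noteq> b"
  shows "\<exists>T B. 0 \<le> T \<and> (\<forall>t\<ge>T. integral {T..t} (\<lambda>s. A s $ i $ j) \<le> B)"
proof -
  define x where "x t = trajectory \<tau> v t" for t
  \<comment> \<open>A third of the gap: with both coordinates within \<delta> of their limits, a
    distance of at least \<delta> remains.\<close>
  define \<delta> where "\<delta> = \<bar>a - b\<bar> / 3"
  have \<delta>: "0 < \<delta>" using \<open>a \<noteq> b\<close> by (simp add: \<delta>_def)
  have "\<forall>\<^sub>F t in at_top. \<bar>x t $ i - a\<bar> < \<delta> \<and> \<bar>x t $ j - b\<bar> < \<delta>"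
    using tendstoD[OF lim(1) \<delta>] tendstoD[OF lim(2) \<delta>]
    by eventually_elim (simp add: x_def dist_real_def)
  then obtain T0 where T0: "\<And>t. T0 \<le> t \<Longrightarrow> \<bar>x t $ i - a\<bar> < \<delta> \<and> \<bar>x t $ j - b\<bar> < \<delta>"
    by (auto simp: eventually_at_top_linorder)
  define T where "T = max \<tau> T0"
  have sep: "\<delta> \<le> \<bar>x s $ j - x t $ i\<bar>" if "T \<le> s" "T \<le> t" for s t
  proof -
    have "\<bar>x s $ j - b\<bar> < \<delta>" "\<bar>x t $ i - a\<bar> < \<delta>" using T0 that by (auto simp: T_def)
    moreover have "3 * \<delta> = \<bar>a - b\<bar>" by (simp add: \<delta>_def)
    ultimately show ?thesis by linarith
  qed
  define V where "V t = (\<Sum>k\<in>UNIV. \<pi> t $ k * (x t $ k)\<^sup>2)" for t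
  \<comment> \<open>The energy price of a unit of flow: p bounds the weight of row i, the square of
    \<delta> bounds the squared difference, and 1/2 comes from
    \<open>transition_entry_lower_bound\<close>.\<close>
  define \<kappa> where "\<kappa> = p * \<delta>\<^sup>2 / 2"
  have \<kappa>: "0 < \<kappa>" using p_pos \<delta> by (simp add: \<kappa>_def)
  have T: "0 \<le> T" "\<tau> \<le> T" using assms(1) by (auto simp: T_def)
  have "\<kappa> * integral {T..t} (\<lambda>r. A r $ i $ j) \<le> V T - V t" if "T \<le> t" for t
    using T(1) that
  proof (rule interval_induct)
    fix r s t assume *: "T \<le> r" "r \<le> s" "s \<le> t"
      "\<kappa> * integral {r..s} (\<lambda>r. A r $ i $ j) \<le> V r - V s" "\<kappa> * integral {s..t} (\<lambda>r. A r $ i $ j) \<le> V s - V t"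
    have "integral {r..t} (\<lambda>r. A r $ i $ j) = integral {r..s} (\<lambda>r. A r $ i $ j) + integral {s..t} (\<lambda>r. A r $ i $ j)"
      using * T(1)
      by (intro Henstock_Kurzweil_Integration.integral_combine[symmetric] entry_integrable) auto
    then show "\<kappa> * integral {r..t} (\<lambda>r. A r $ i $ j) \<le> V r - V t"
      using *(4,5) by (simp add: distrib_left)
  next
    fix s t assume st: "T \<le> s" "s \<le> t" and small: "integral {s..t} total_rate \<le> 1/4"
    have s0: "0 \<le> s" "0 \<le> t" "\<tau> \<le> s" using T st by auto
    define W where "W k = (\<Sum>l\<in>UNIV. state_transition A t s $ k $ l * (x s $ l - x t $ k)\<^sup>2)" for k
    have W: "0 \<le> W k" for k
      unfolding W_def using transition_nonneg[OF s0(1) st(2)] by (intro sum_nonneg) auto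
    have "\<kappa> * integral {s..t} (\<lambda>r. A r $ i $ j) = p * ((1/2 * integral {s..t} (\<lambda>r. A r $ i $ j)) * \<delta>\<^sup>2)"
      by (simp add: \<kappa>_def)
    also have "\<dots> \<le> p * (state_transition A t s $ i $ j * (x s $ j - x t $ i)\<^sup>2)"
    proof (intro mult_left_mono mult_mono)
      show "1/2 * integral {s..t} (\<lambda>r. A r $ i $ j) \<le> state_transition A t s $ i $ j"
        by (rule transition_entry_lower_bound[OF s0(1) st(2) small assms(2)])
      show "\<delta>\<^sup>2 \<le> (x s $ j - x t $ i)\<^sup>2"
        using sep[of s t] st \<delta> abs_le_square_iff[of \<delta> "x s $ j - x t $ i"] by simp
    qed (use transition_nonneg[OF s0(1) st(2)] p_pos in auto)
    also have "\<dots> \<le> p * W i"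
      unfolding W_def using transition_nonneg[OF s0(1) st(2)] p_pos
      by (intro mult_left_mono member_le_sum) auto
    also have "\<dots> \<le> \<pi> t $ i * W i"
      using p_less[OF s0(2), of i] W by (intro mult_right_mono) auto
    also have "\<dots> \<le> (\<Sum>k\<in>UNIV. \<pi> t $ k * W k)"
      using pi_nonneg[OF s0(2)] W by (intro member_le_sum) auto
    also have "\<dots> = V s - V t"
      unfolding V_def W_def x_def using energy_dissipation_identity[OF assms(1) s0(3) st(2)] by simp
    finally show "\<kappa> * integral {s..t} (\<lambda>r. A r $ i $ j) \<le> V s - V t" .
  qed
  moreover have "0 \<le> V t" if "T \<le> t" for t
    unfolding V_def using pi_nonneg[of t] that T by (intro sum_nonneg) auto
  ultimately have "integral {T..t} (\<lambda>r. A r $ i $ j) \<le> V T / \<kappa>" if "T \<le> t" for t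
    using that \<kappa> by (fastforce simp: field_simps)
  then show ?thesis using T(1) by blast
qed

text \<open>An edge says only that the two directed flows together are infinite. Unequal limits
  bound the flow in each direction, by exchanging i and j, and hence the sum.\<close>

lemma limits_agree_on_edges:
  assumes "0 \<le> \<tau>" "(i, j) \<in> infinite_flow_edges A"
    and lim: "((\<lambda>t. trajectory \<tau> v t $ i) \<longlongrightarrow> a) at_top" "((\<lambda>t. trajectory \<tau> v t $ j) \<longlongrightarrow> b) at_top"
  shows "a = b"
proof (rule ccontr)
  assume "a \<noteq> b"
  have "i \<noteq> j" using assms(2) by (simp add: infinite_flow_edges_def)
  have bound: "\<exists>B. \<forall>t\<ge>0. integral {0..t} (\<lambda>s. A s $ k $ l) \<le> B"
    if "k \<noteq> l" and T: "\<exists>T B. 0 \<le> T \<and> (\<forall>t\<ge>T. integral {T..t} (\<lambda>s. A s $ k $ l) \<le> B)" for k l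
  proof -
    obtain T B where TB: "0 \<le> T" "\<And>t. T \<le> t \<Longrightarrow> integral {T..t} (\<lambda>s. A s $ k $ l) \<le> B"
      using T by blast
    have "integral {0..t} (\<lambda>s. A s $ k $ l) \<le> integral {0..T} (\<lambda>s. A s $ k $ l) + B" if "0 \<le> t" for t
    proof -
      \<comment> \<open>Extending to \<open>max t T\<close> covers times before \<open>T\<close>,
        since the integrand is nonnegative.\<close>
      have "integral {0..t} (\<lambda>s. A s $ k $ l) \<le> integral {0..max t T} (\<lambda>s. A s $ k $ l)"
        using \<open>k \<noteq> l\<close> by (intro integral_subset_le entry_integrable) (auto intro: offdiag_nonneg)
      also have "\<dots> = integral {0..T} (\<lambda>s. A s $ k $ l) + integral {T..max t T} (\<lambda>s. A s $ k $ l)"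
        using TB(1)
        by (intro Henstock_Kurzweil_Integration.integral_combine[symmetric] entry_integrable) auto
      finally show ?thesis using TB(2)[of "max t T"] by simp
    qed
    then show ?thesis by blast
  qed
  obtain B1 where B1: "\<And>t. 0 \<le> t \<Longrightarrow> integral {0..t} (\<lambda>s. A s $ i $ j) \<le> B1"
    using bound[OF \<open>i \<noteq> j\<close> limits_agree_on_positive_flow[OF assms(1) \<open>i \<noteq> j\<close> lim \<open>a \<noteq> b\<close>]] by blast
  obtain B2 where B2: "\<And>t. 0 \<le> t \<Longrightarrow> integral {0..t} (\<lambda>s. A s $ j $ i) \<le> B2"
    using bound[OF _ limits_agree_on_positive_flow[OF assms(1) _ lim(2,1)]] \<open>i \<noteq> j\<close> \<open>a \<noteq> b\<close> by metis
  have "integral {0..t} (\<lambda>s. A s $ i $ j + A s $ j $ i) \<le> B1 + B2" if "0 \<le> t" for t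
    using B1[OF that] B2[OF that]
    by (subst Henstock_Kurzweil_Integration.integral_add) (auto intro: entry_integrable)
  then show False using infinite_flow_edge_iff[OF \<open>i \<noteq> j\<close>] assms(2) by blast
qed

end

section \<open>Components and the limit map\<close>

text \<open>The indicator vectors of the classes form a basis: they are orthogonal because classes
  are disjoint, nonzero because classes are nonempty, and the coefficient of a class is the value at
  any representative.\<close>

lemma dim_constant_on_classes:
  fixes r :: "('n::finite \<times> 'n) set"
  assumes "equiv UNIV r"
  shows "dim {v :: real ^ 'n. \<forall>i j. (i, j) \<in> r \<longrightarrow> v $ i = v $ j} = card (UNIV // r)"
proof -
  define ind :: "'n set \<Rightarrow> real ^ 'n" where "ind C = (\<chi> i. if i \<in> C then 1 else 0)" for C
  have mem: "k \<in> C \<longleftrightarrow> C = r `` {k}" if "C \<in> UNIV // r" for C k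
    using that assms by (metis Image_singleton_iff UNIV_I equiv_class_self quotientI quotient_disj
        disjoint_iff)
  have inj: "inj_on ind (UNIV // r)"
  proof (rule inj_onI)
    fix C D assume "ind C = ind D"
    then have "i \<in> C \<longleftrightarrow> i \<in> D" for i
      by (metis (mono_tags, lifting) ind_def vec_lambda_beta zero_neq_one)
    then show "C = D" by blast
  qed
  show ?thesis
  proof (rule dim_unique)
    show "ind ` (UNIV // r) \<subseteq> {v. \<forall>i j. (i, j) \<in> r \<longrightarrow> v $ i = v $ j}"
    proof clarsimp
      fix C i j assume C: "C \<in> UNIV // r" and "(i, j) \<in> r"
      then have "r `` {i} = r `` {j}" using assms equiv_class_eq by metis
      then show "ind C $ i = ind C $ j" using mem[OF C] by (simp add: ind_def)
    qed
    show "{v. \<forall>i j. (i, j) \<in> r \<longrightarrow> v $ i = v $ j} \<subseteq> span (ind ` (UNIV // r))"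
    proof
      fix v :: "real ^ 'n" assume v: "v \<in> {v. \<forall>i j. (i, j) \<in> r \<longrightarrow> v $ i = v $ j}"
      define rep where "rep C = (SOME i. i \<in> C)" for C :: "'n set"
      have "v = (\<Sum>C\<in>UNIV // r. (v $ rep C) *\<^sub>R ind C)"
      proof (rule vec_eq_iff[THEN iffD2], rule allI)
        fix k
        have "rep (r `` {k}) \<in> r `` {k}"
          unfolding rep_def by (rule someI[of _ k]) (use assms equiv_class_self in fastforce)
        then have vk: "v $ rep (r `` {k}) = v $ k" using v by auto
        have "(\<Sum>C\<in>UNIV // r. (v $ rep C) *\<^sub>R ind C) $ k =
            (\<Sum>C\<in>UNIV // r. if C = r `` {k} then v $ rep C else 0)"
          unfolding sum_component using mem by (intro sum.cong) (auto simp: ind_def)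
        also have "\<dots> = v $ k"
          using vk by (simp add: quotientI)
        finally show "v $ k = (\<Sum>C\<in>UNIV // r. (v $ rep C) *\<^sub>R ind C) $ k" ..
      qed
      moreover have "(\<Sum>C\<in>UNIV // r. (v $ rep C) *\<^sub>R ind C) \<in> span (ind ` (UNIV // r))"
        by (intro span_sum span_scale span_base) auto
      ultimately show "v \<in> span (ind ` (UNIV // r))" by simp
    qed
    show "independent (ind ` (UNIV // r))"
    proof (rule pairwise_orthogonal_independent)
      show "pairwise orthogonal (ind ` (UNIV // r))"
      proof (clarsimp simp: pairwise_def)
        fix C D assume CD: "C \<in> UNIV // r" "D \<in> UNIV // r" "ind C \<noteq> ind D"
        then have "C \<inter> D = {}" using quotient_disj[OF assms] by blast
        then show "orthogonal (ind C) (ind D)"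
          unfolding orthogonal_def inner_vec_def by (intro sum.neutral) (auto simp: ind_def)
      qed
      show "0 \<notin> ind ` (UNIV // r)"
      proof
        assume "0 \<in> ind ` (UNIV // r)"
        then obtain C where C: "C \<in> UNIV // r" "ind C = 0" by auto
        then obtain i where "i \<in> C" using in_quotient_imp_non_empty[OF assms] by blast
        then have "ind C $ i = 1" by (simp add: ind_def)
        then show False using C(2) by simp
      qed
    qed
    show "card (ind ` (UNIV // r)) = card (UNIV // r)"
      by (rule card_image[OF inj])
  qed
qed

context ct_chain
begin

section \<open>Flow between distinct components\<close>

definition linked :: "('n \<times> 'n) set" where
  "linked = (infinite_flow_edges A)\<^sup>*"

lemma equiv_linked: "equiv UNIV linked"
  unfolding linked_def
  by (intro equivI refl_rtrancl sym_rtrancl infinite_flow_edges_sym trans_rtrancl) auto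

definition component_space :: "(real ^ 'n) set" where
  "component_space = {v. \<forall>i j. (i, j) \<in> linked \<longrightarrow> v $ i = v $ j}"

lemma subspace_component_space: "subspace component_space"
  unfolding subspace_def component_space_def
proof (intro conjI ballI allI)
  fix v w :: "real ^ 'n" and c :: real
  assume v: "v \<in> {v. \<forall>i j. (i, j) \<in> linked \<longrightarrow> v $ i = v $ j}"
  then show "c *\<^sub>R v \<in> {v. \<forall>i j. (i, j) \<in> linked \<longrightarrow> v $ i = v $ j}" by simp
  assume "w \<in> {v. \<forall>i j. (i, j) \<in> linked \<longrightarrow> v $ i = v $ j}"
  with v have "(v + w) $ i = (v + w) $ j" if "(i, j) \<in> linked" for i j
    using that unfolding mem_Collect_eq vector_add_component by metis
  then show "v + w \<in> {v. \<forall>i j. (i, j) \<in> linked \<longrightarrow> v $ i = v $ j}" by blast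
qed simp

definition cross_rate :: "real \<Rightarrow> real" where
  "cross_rate s = (\<Sum>(i, j)\<in>- linked. A s $ i $ j)"

lemma not_linked_neq: "(i, j) \<notin> linked \<Longrightarrow> i \<noteq> j"
  by (auto simp: linked_def)

lemma cross_rate_nonneg: "0 \<le> s \<Longrightarrow> 0 \<le> cross_rate s"
  unfolding cross_rate_def using not_linked_neq offdiag_nonneg by (intro sum_nonneg) fastforce

lemma cross_rate_integrable: "0 \<le> a \<Longrightarrow> cross_rate integrable_on {a..b}"
  unfolding cross_rate_def[abs_def] case_prod_beta by (intro integrable_sum entry_integrable) auto

text \<open>A pair outside \<open>linked\<close> is not an edge, so its flow in both directions
  together is finite, and the reverse entry is nonnegative. There are only finitely many such
  pairs.\<close>

lemma cross_rate_bounded: "\<exists>B. \<forall>t\<ge>0. integral {0..t} cross_rate \<le> B"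
proof -
  have "\<exists>B. \<forall>t\<ge>0. integral {0..t} (\<lambda>s. A s $ fst e $ snd e) \<le> B" if e: "e \<in> - linked" for e
  proof -
    obtain i j where ij: "e = (i, j)" by force
    have "i \<noteq> j" using not_linked_neq e ij by simp
    moreover have "(i, j) \<notin> infinite_flow_edges A" using e ij by (auto simp: linked_def)
    ultimately obtain B where B: "\<And>t. 0 \<le> t \<Longrightarrow> integral {0..t} (\<lambda>s. A s $ i $ j + A s $ j $ i) \<le> B"
      using infinite_flow_edge_iff by blast
    have "integral {0..t} (\<lambda>s. A s $ i $ j) \<le> integral {0..t} (\<lambda>s. A s $ i $ j + A s $ j $ i)" for t
      by (intro integral_le integrable_add entry_integrable)
        (use \<open>i \<noteq> j\<close> offdiag_nonneg[of _ j i] in auto)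
    then show ?thesis using B ij by (auto intro: order_trans)
  qed
  then have "\<forall>e. \<exists>B. e \<in> - linked \<longrightarrow> (\<forall>t\<ge>0. integral {0..t} (\<lambda>s. A s $ fst e $ snd e) \<le> B)"
    by blast
  from choice[OF this] obtain B where
    B: "\<And>e t. e \<in> - linked \<Longrightarrow> 0 \<le> t \<Longrightarrow> integral {0..t} (\<lambda>s. A s $ fst e $ snd e) \<le> B e" by blast
  have "integral {0..t} cross_rate \<le> sum B (- linked)" if "0 \<le> t" for t
  proof -
    have "integral {0..t} cross_rate = (\<Sum>e\<in>- linked. integral {0..t} (\<lambda>s. A s $ fst e $ snd e))"
      unfolding cross_rate_def[abs_def] case_prod_beta
      by (rule Henstock_Kurzweil_Integration.integral_sum) (auto intro: entry_integrable)
    also have "\<dots> \<le> sum B (- linked)" using B that by (intro sum_mono) auto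
    finally show ?thesis .
  qed
  then show ?thesis by blast
qed

text \<open>Bounded nondecreasing integrals converge, so late increments are small. The injectivity
  argument for the limit map needs a tail below 1/2.\<close>

lemma cross_rate_tail:
  "\<exists>T0\<ge>0. \<forall>T\<ge>T0. \<forall>t\<ge>T. integral {T..t} cross_rate \<le> 1/4"
proof -
  define I where "I t = integral {0..t} cross_rate" for t
  have add: "I s + integral {s..t} cross_rate = I t" if "0 \<le> s" "s \<le> t" for s t
    unfolding I_def using that
    by (intro Henstock_Kurzweil_Integration.integral_combine cross_rate_integrable) auto
  have nonneg: "0 \<le> integral {s..t} cross_rate" if "0 \<le> s" for s t
    using that by (intro Henstock_Kurzweil_Integration.integral_nonneg cross_rate_integrable cross_rate_nonneg) auto
  obtain B where B: "\<And>t. 0 \<le> t \<Longrightarrow> I t \<le> B" unfolding I_def using cross_rate_bounded by blast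
  have "\<exists>l. ((\<lambda>t. - I t) \<longlongrightarrow> l) at_top"
  proof (rule antimono_convergent_at_top[of 0 _ "- B"])
    show "- I t \<le> - I s" if "0 \<le> s" "s \<le> t" for s t
      using add[OF that] nonneg[OF that(1), of t] by simp
  qed (use B in simp)
  then obtain l where "((\<lambda>t. - I t) \<longlongrightarrow> l) at_top" by blast
  then have "\<forall>\<^sub>F t in at_top. dist (- I t) l < 1/8" by (rule tendstoD) simp
  then obtain T0 where T0: "\<And>t. T0 \<le> t \<Longrightarrow> dist (- I t) l < 1/8"
    by (auto simp: eventually_at_top_linorder)
  have "integral {T..t} cross_rate \<le> 1/4" if "max 0 T0 \<le> T" "T \<le> t" for T t
  proof -
    have "\<bar>- I T - l\<bar> < 1/8" "\<bar>- I t - l\<bar> < 1/8"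
      using T0[of T] T0[of t] that by (simp_all add: dist_real_def)
    then show ?thesis using add[of T t] that by linarith
  qed
  then show ?thesis by (intro exI[of _ "max 0 T0"]) auto
qed

text \<open>Start a trajectory from the indicator of the component C of i; its coordinate k at time
  t is the mass that row k keeps in C. For k in C, terms leading out of C lower this mass at rate at
  most \<open>cross_rate\<close>, because all values lie in [0, 1]. Adding the accumulated leak e
  yields a family on which the minimum principle with S = C applies.\<close>

lemma transition_component_mass:
  assumes "0 \<le> T" "T \<le> t"
  shows "1 - integral {T..t} cross_rate \<le> (\<Sum>j\<in>linked `` {i}. state_transition A t T $ i $ j)"
proof -
  define C where "C = linked `` {i}"
  have iC: "i \<in> C" by (simp add: C_def linked_def)
  define x where "x = trajectory T (\<chi> j. if j \<in> C then 1 else 0)"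
  define e where "e q = integral {T..q} cross_rate" for q
  have x: "x q $ k = (\<Sum>j\<in>C. state_transition A q T $ k $ j)" for q k
  proof -
    have "x q $ k = (\<Sum>j\<in>UNIV. if j \<in> C then state_transition A q T $ k $ j else 0)"
      unfolding x_def trajectory_component by (intro sum.cong) auto
    also have "\<dots> = (\<Sum>j\<in>UNIV \<inter> C. state_transition A q T $ k $ j)"
      by (rule sum.inter_restrict[symmetric]) simp
    finally show ?thesis by simp
  qed
  have x01: "0 \<le> x q $ k" "x q $ k \<le> 1" if "T \<le> q" for q k
  proof -
    show "0 \<le> x q $ k" unfolding x using transition_nonneg[OF assms(1) that] by (intro sum_nonneg)
    have "x q $ k \<le> (\<Sum>j\<in>UNIV. state_transition A q T $ k $ j)"
      unfolding x using transition_nonneg[OF assms(1) that] by (intro sum_mono2) auto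
    then show "x q $ k \<le> 1" using transition_row_sum[OF assms(1) that] by simp
  qed
  have cont: "continuous_on {a..b} (\<lambda>q. x q $ k)" if "T \<le> a" for a b k
    unfolding x_def
    by (intro continuous_on_component continuous_on_subset[OF trajectory_continuous[OF assms(1)]])
      (use that in auto)
  have "0 \<le> x t $ i - 1 + e t"
  proof (rule supersolution_nonneg[OF assms, of C "\<lambda>k q. x q $ k - 1 + e q"])
    show "continuous_on {T..t} (\<lambda>q. x q $ k - 1 + e q)" for k
      unfolding e_def
      by (intro continuous_on_add continuous_on_diff continuous_on_const cont order_refl
          indefinite_integral_continuous_1 cross_rate_integrable assms)
    show "0 \<le> x T $ k - 1 + e T" if "k \<in> C" for k
      using that trajectory_solves(2)[OF assms(1)] by (simp add: x_def e_def)
    fix k r q assume k: "k \<in> C" and rq: "T \<le> r" "r \<le> q" "q \<le> t"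
    have r0: "0 \<le> r" using rq assms by simp
    have inc: "((\<lambda>s. \<Sum>j\<in>UNIV. A s $ k $ j * x s $ j) has_integral (x q $ k - x r $ k)) {r..q}"
      unfolding x_def by (rule trajectory_increment[OF assms(1) rq(1,2)])
    have eadd: "e r + integral {r..q} cross_rate = e q"
      unfolding e_def using rq assms
      by (intro Henstock_Kurzweil_Integration.integral_combine cross_rate_integrable) auto
    have "integral {r..q} (\<lambda>s. \<Sum>j\<in>C. A s $ k $ j * (x s $ j - x s $ k)) \<le>
        integral {r..q} (\<lambda>s. (\<Sum>j\<in>UNIV. A s $ k $ j * x s $ j) + cross_rate s)"
    proof (rule integral_le)
      show "(\<lambda>s. \<Sum>j\<in>C. A s $ k $ j * (x s $ j - x s $ k)) integrable_on {r..q}"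
        by (intro row_sum_integrable continuous_on_diff cont rq r0)
      show "(\<lambda>s. (\<Sum>j\<in>UNIV. A s $ k $ j * x s $ j) + cross_rate s) integrable_on {r..q}"
        using inc by (intro integrable_add cross_rate_integrable r0) blast
      fix s assume s: "s \<in> {r..q}"
      then have s0: "0 \<le> s" "T \<le> s" using r0 rq by auto
      \<comment> \<open>By transitivity, all pairs from k to the complement of C are counted in
        \<open>cross_rate\<close>.\<close>
      have out: "(k, j) \<in> - linked" if "j \<in> - C" for j
        using k that equiv_linked unfolding C_def equiv_def trans_def by auto
      have "(\<Sum>j\<in>- C. A s $ k $ j) = (\<Sum>e\<in>Pair k ` (- C). A s $ fst e $ snd e)"
        by (subst sum.reindex) (auto simp: inj_on_def)
      also have "\<dots> \<le> (\<Sum>e\<in>- linked. A s $ fst e $ snd e)"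
        using out not_linked_neq s0 by (intro sum_mono2) (auto intro!: offdiag_nonneg)
      also have "\<dots> = cross_rate s" by (simp add: cross_rate_def case_prod_beta)
      finally have leak: "(\<Sum>j\<in>- C. A s $ k $ j) \<le> cross_rate s" .
      have "- (\<Sum>j\<in>- C. A s $ k $ j) = (\<Sum>j\<in>- C. A s $ k $ j * (- 1))"
        by (simp add: sum_negf)
      also have "\<dots> \<le> (\<Sum>j\<in>- C. A s $ k $ j * (x s $ j - x s $ k))"
      proof (intro sum_mono mult_left_mono)
        fix j assume "j \<in> - C"
        then show "0 \<le> A s $ k $ j" using k s0 by (intro offdiag_nonneg) auto
        show "- 1 \<le> x s $ j - x s $ k" using x01[OF s0(2), of j] x01[OF s0(2), of k] by simp
      qed
      finally have "- cross_rate s \<le> (\<Sum>j\<in>- C. A s $ k $ j * (x s $ j - x s $ k))"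
        using leak by simp
      moreover have "(\<Sum>j\<in>C. A s $ k $ j * (x s $ j - x s $ k)) + (\<Sum>j\<in>- C. A s $ k $ j * (x s $ j - x s $ k))
          = (\<Sum>j\<in>UNIV. A s $ k $ j * (x s $ j - x s $ k))"
        by (subst sum.union_disjoint[symmetric]) (auto simp: Compl_partition)
      moreover have "\<dots> = (\<Sum>j\<in>UNIV. A s $ k $ j * x s $ j)"
        using row_sum[OF s0(1), of k]
        by (simp add: right_diff_distrib sum_subtractf flip: sum_distrib_right)
      ultimately show "(\<Sum>j\<in>C. A s $ k $ j * (x s $ j - x s $ k)) \<le>
          (\<Sum>j\<in>UNIV. A s $ k $ j * x s $ j) + cross_rate s" by linarith
    qed
    also have "\<dots> = (x q $ k - x r $ k) + integral {r..q} cross_rate"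
      using inc integral_unique[OF inc]
      by (subst Henstock_Kurzweil_Integration.integral_add) (auto intro: cross_rate_integrable r0)
    finally show "integral {r..q} (\<lambda>s. \<Sum>j\<in>C. A s $ k $ j * (x s $ j - 1 + e s - (x s $ k - 1 + e s)))
        \<le> x q $ k - 1 + e q - (x r $ k - 1 + e r)"
      using eadd by simp
  qed (rule iC)
  then show ?thesis unfolding x e_def C_def by simp
qed

end

context p_star_chain
begin

section \<open>The limit map and its kernel\<close>

definition limit_map :: "real \<Rightarrow> real ^ 'n \<Rightarrow> real ^ 'n" where
  "limit_map \<tau> v = Lim at_top (trajectory \<tau> v)"

lemma limit_map_tendsto:
  assumes "0 \<le> \<tau>"
  shows "(trajectory \<tau> v \<longlongrightarrow> limit_map \<tau> v) at_top"
proof -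
  have "\<forall>i. \<exists>l. ((\<lambda>t. trajectory \<tau> v t $ i) \<longlongrightarrow> l) at_top"
    using trajectory_component_convergent[OF assms] by blast
  from choice[OF this] obtain l where "\<And>i. ((\<lambda>t. trajectory \<tau> v t $ i) \<longlongrightarrow> l i) at_top" by blast
  then have "(trajectory \<tau> v \<longlongrightarrow> (\<chi> i. l i)) at_top" by (intro vec_tendstoI) simp
  then show ?thesis unfolding limit_map_def by (metis tendsto_Lim trivial_limit_at_top_linorder)
qed

lemma limit_map_eqI:
  assumes "0 \<le> \<tau>" "(trajectory \<tau> v \<longlongrightarrow> l) at_top"
  shows "limit_map \<tau> v = l"
  using tendsto_unique[OF _ limit_map_tendsto[OF assms(1)] assms(2)] by simp

lemma linear_limit_map:
  assumes "0 \<le> \<tau>"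
  shows "linear (limit_map \<tau>)"
proof (rule linearI)
  show "limit_map \<tau> (v + w) = limit_map \<tau> v + limit_map \<tau> w" for v w
    using tendsto_add[OF limit_map_tendsto[OF assms] limit_map_tendsto[OF assms], of v w]
    by (intro limit_map_eqI[OF assms]) (simp add: linear_add[OF linear_trajectory, symmetric])
  show "limit_map \<tau> (c *\<^sub>R v) = c *\<^sub>R limit_map \<tau> v" for c v
    using tendsto_scaleR[OF tendsto_const limit_map_tendsto[OF assms], of c v]
    by (intro limit_map_eqI[OF assms]) (simp add: linear_cmul[OF linear_trajectory, symmetric])
qed

lemma limit_map_trajectory:
  assumes "0 \<le> \<tau>" "\<tau> \<le> s"
  shows "limit_map s (trajectory \<tau> v s) = limit_map \<tau> v"
proof (rule limit_map_eqI)
  show "0 \<le> s" using assms by simp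
  have "\<forall>\<^sub>F t in at_top. trajectory \<tau> v t = trajectory s (trajectory \<tau> v s) t"
    using eventually_ge_at_top[of s] by eventually_elim (simp add: trajectory_semigroup assms)
  then show "(trajectory s (trajectory \<tau> v s) \<longlongrightarrow> limit_map \<tau> v) at_top"
    using limit_map_tendsto[OF assms(1)] by (rule Lim_transform_eventually[rotated])
qed

lemma null_space_eq:
  assumes "0 \<le> \<tau>"
  shows "null_space_at A \<tau> = {v. limit_map \<tau> v = 0}"
proof -
  have "v \<in> null_space_at A \<tau> \<longleftrightarrow> (trajectory \<tau> v \<longlongrightarrow> 0) at_top" for v
    by (simp add: null_space_at_def trajectory_def[abs_def])
  then show ?thesis
    using limit_map_eqI[OF assms] limit_map_tendsto[OF assms] by (metis (mono_tags, lifting) mem_Collect_eq set_eqI)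
qed

lemma limit_map_in_component_space:
  assumes "0 \<le> \<tau>"
  shows "limit_map \<tau> v \<in> component_space"
proof -
  have "limit_map \<tau> v $ i = limit_map \<tau> v $ j" if "(i, j) \<in> (infinite_flow_edges A)\<^sup>*" for i j
    using that
  proof (induction rule: rtrancl_induct)
    case (step j k)
    have "limit_map \<tau> v $ j = limit_map \<tau> v $ k"
      by (rule limits_agree_on_edges[OF assms step(2), where v=v])
        (intro tendsto_vec_nth limit_map_tendsto assms)+
    then show ?case using step.IH by simp
  qed simp
  then show ?thesis by (auto simp: component_space_def linked_def)
qed

text \<open>Look at a coordinate i where |v_i| is the maximum M. Since v is constant on the
  component of i, only the mass of row i outside it, at most 1/4, moves the value, and by at most 2M
  per unit of mass. So |x_i(t)| \<ge> M/2 for all t \<ge> T, and also in the limit.\<close>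

lemma limit_map_injective_on_component_space:
  assumes "0 \<le> T" and tail: "\<And>t. T \<le> t \<Longrightarrow> integral {T..t} cross_rate \<le> 1/4"
    and v: "v \<in> component_space" and zero: "limit_map T v = 0"
  shows "v = 0"
proof -
  define M where "M = Max (range (\<lambda>i. \<bar>v $ i\<bar>))"
  have "M \<in> range (\<lambda>i. \<bar>v $ i\<bar>)" unfolding M_def by (rule Max_in) auto
  then obtain i where i: "M = \<bar>v $ i\<bar>" by auto
  have M: "\<bar>v $ j\<bar> \<le> M" for j unfolding M_def by (rule Max_ge) auto
  define C where "C = linked `` {i}"
  have half: "M / 2 \<le> \<bar>trajectory T v t $ i\<bar>" if "T \<le> t" for t
  proof -
    define m where "m j = state_transition A t T $ i $ j" for j
    have m0: "0 \<le> m j" for j unfolding m_def by (rule transition_nonneg[OF assms(1) that])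
    have "(\<Sum>j\<in>C. m j) + (\<Sum>j\<in>- C. m j) = (\<Sum>j\<in>UNIV. m j)"
      by (subst sum.union_disjoint[symmetric]) (auto simp: Compl_partition)
    also have "\<dots> = 1" unfolding m_def by (rule transition_row_sum[OF assms(1) that])
    finally have out: "(\<Sum>j\<in>- C. m j) \<le> 1/4"
      using transition_component_mass[OF assms(1) that, of i] tail[OF that] by (simp add: C_def m_def)
    have "trajectory T v t $ i - v $ i = (\<Sum>j\<in>UNIV. m j * (v $ j - v $ i))"
      using transition_row_sum[OF assms(1) that, of i] unfolding trajectory_component m_def
      by (simp add: right_diff_distrib sum_subtractf flip: sum_distrib_right)
    also have "\<dots> = (\<Sum>j\<in>- C. m j * (v $ j - v $ i))"
      using v by (intro sum.mono_neutral_right) (auto simp: C_def component_space_def)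
    also have "\<bar>\<dots>\<bar> \<le> (\<Sum>j\<in>- C. m j * (2 * M))"
    proof (rule order_trans[OF sum_abs], rule sum_mono)
      fix j
      have "\<bar>v $ j - v $ i\<bar> \<le> 2 * M" using M[of i] M[of j] by linarith
      then show "\<bar>m j * (v $ j - v $ i)\<bar> \<le> m j * (2 * M)"
        using m0[of j] by (simp add: abs_mult mult_left_mono)
    qed
    also have "\<dots> = (\<Sum>j\<in>- C. m j) * (2 * M)" by (simp add: sum_distrib_right)
    also have "\<dots> \<le> 1/4 * (2 * M)" using out i by (intro mult_right_mono) auto
    finally show ?thesis using i by linarith
  qed
  have "M / 2 \<le> \<bar>limit_map T v $ i\<bar>"
  proof (rule tendsto_lowerbound)
    show "((\<lambda>t. \<bar>trajectory T v t $ i\<bar>) \<longlongrightarrow> \<bar>limit_map T v $ i\<bar>) at_top"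
      by (intro tendsto_rabs tendsto_vec_nth limit_map_tendsto assms)
    show "\<forall>\<^sub>F t in at_top. M / 2 \<le> \<bar>trajectory T v t $ i\<bar>"
      using eventually_ge_at_top[of T] by eventually_elim (rule half)
  qed simp
  then have "M \<le> 0" using zero by simp
  then have "v $ j = 0" for j using M[of j] by simp
  then show ?thesis by (simp add: vec_eq_iff)
qed

text \<open>Injectivity on the component space needs a late starting time T, whereas \<tau> is
  arbitrary. The flow from \<tau> to T is an injective linear endomorphism, hence bijective, and
  carries the null space at \<tau> onto the one at T.\<close>

lemma dim_null_space:
  assumes "0 \<le> \<tau>"
  shows "dim (null_space_at A \<tau>) + dim component_space = CARD('n)"
proof -
  obtain T0 where T0: "0 \<le> T0" "\<And>T t. T0 \<le> T \<Longrightarrow> T \<le> t \<Longrightarrow> integral {T..t} cross_rate \<le> 1/4"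
    using cross_rate_tail by blast
  define T where "T = max \<tau> T0"
  have T: "0 \<le> T" "\<tau> \<le> T" "T0 \<le> T" using assms by (auto simp: T_def)
  define f where "f = limit_map T"
  have f: "linear f" unfolding f_def by (rule linear_limit_map[OF T(1)])
  have inj0: "v = 0" if "v \<in> component_space" "f v = 0" for v
    using limit_map_injective_on_component_space[OF T(1) T0(2)[OF T(3)]] that by (simp add: f_def)
  have "inj_on f component_space"
    by (subst linear_inj_on_iff_eq_0[OF f subspace_component_space]) (use inj0 in blast)
  then have "dim (f ` component_space) = dim component_space"
    by (intro dim_image_eq[OF f]) (simp add: span_eq_iff[THEN iffD2, OF subspace_component_space])
  moreover have "f ` component_space \<subseteq> component_space"
    unfolding f_def using limit_map_in_component_space[OF T(1)] by blast
  \<comment> \<open>An injective linear map of a finite-dimensional space into itself is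
    onto.\<close>
  ultimately have image: "f ` component_space = component_space"
    by (intro subspace_dim_equal linear_subspace_image[OF f] subspace_component_space) auto
  define N where "N = {v. f v = 0}"
  have N: "subspace N" unfolding N_def by (rule linear_subspace_kernel[OF f])
  have "N \<inter> component_space = {0}"
    using inj0 linear_0[OF f] subspace_0[OF subspace_component_space] by (auto simp: N_def)
  moreover have "{x + y |x y. x \<in> N \<and> y \<in> component_space} = UNIV"
  proof (intro equalityI subset_UNIV subsetI)
    fix v
    have "f v \<in> f ` component_space"
      unfolding image unfolding f_def by (rule limit_map_in_component_space[OF T(1)])
    then obtain u where u: "u \<in> component_space" "f v = f u" by blast
    then have "v - u \<in> N" by (simp add: N_def linear_diff[OF f])
    moreover have "v = (v - u) + u" by simp
    ultimately show "v \<in> {x + y |x y. x \<in> N \<and> y \<in> component_space}" using u(1) by blast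
  qed
  ultimately have "dim N + dim component_space = CARD('n)"
    using dim_sums_Int[OF N subspace_component_space] by simp
  moreover have "dim N = dim (null_space_at A \<tau>)"
  proof -
    define g where "g v = trajectory \<tau> v T" for v
    have g: "linear g" unfolding g_def by (rule linear_trajectory)
    have "inj g"
      using linear_injective_0[OF g] trajectory_eq_zero[OF assms T(2)] by (auto simp: g_def)
    then have "surj g" using linear_injective_imp_surjective[OF g] by simp
    have "g ` null_space_at A \<tau> = N"
    proof -
      have "limit_map \<tau> v = f (g v)" for v
        unfolding f_def g_def using limit_map_trajectory[OF assms T(2)] by simp
      then show ?thesis
        unfolding null_space_eq[OF assms] N_def using \<open>surj g\<close> by (auto simp: image_iff surj_def)
    qed
    then show ?thesis
      using dim_image_eq[OF g, of "null_space_at A \<tau>"] \<open>inj g\<close> inj_on_subset by (metis subset_UNIV)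
  qed
  ultimately show ?thesis by simp
qed

end

theorem corollary6:
  fixes A :: "real \<Rightarrow> real ^ 'n ^ 'n"
  assumes "continuous_time_chain A"
    and "class_P_star A"
  shows "chain_rank A = card (connected_components_of_graph (infinite_flow_edges A))"
proof -
  obtain \<pi> p where "absolute_probability_sequence A \<pi>" "0 < p" "\<forall>t\<ge>0. \<forall>i. p < \<pi> t $ i"
    using assms(2) unfolding class_P_star_def by blast
  then interpret p_star_chain A \<pi> p
    using assms(1) by unfold_locales auto
  have dim: "dim component_space = card (connected_components_of_graph (infinite_flow_edges A))"
    unfolding component_space_def connected_components_of_graph_def
    using dim_constant_on_classes[OF equiv_linked] by (simp add: linked_def)
  have "chain_nullity A = CARD('n) - dim component_space"
    unfolding chain_nullity_def
  proof (rule the_equality)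
    show all: "\<forall>\<tau>\<ge>0. dim (null_space_at A \<tau>) = CARD('n) - dim component_space"
      using dim_null_space by (metis add_diff_cancel_right')
    show "d = CARD('n) - dim component_space" if "\<forall>\<tau>\<ge>0. dim (null_space_at A \<tau>) = d" for d
      using that all by (metis order_refl)
  qed
  \<comment> \<open>Needed because N - (N - dim) is a truncated difference of naturals.\<close>
  moreover have "dim component_space \<le> CARD('n)"
    using dim_null_space[of 0] by linarith
  ultimately show ?thesis unfolding chain_rank_def dim[symmetric] by simp
qed

end
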